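(* Let $X$ be a Polish space and let $\rho : X\times X \to [0,+\infty]$ be a Borel proper extended metric on $X$. Then there is an $E_\rho$-invariant comeager Borel set $X' \subseteq X$ such that $\mathrm{asdim}_{\mathbf{B}}(X',\rho) = \mathrm{asdim}(X',\rho)$, where on both sides $\rho$ is restricted to $X'$.
   Context: An extended metric is a metric allowed to take the value $+\infty$. It is proper if every ball of finite radius has finite cardinality. The metric $\rho$ need not be related to the topology of $X$ except that it is a Borel function. Balls $B(x;r)$ are closed $\rho$-balls. Put $E_\rho = \{(x,y) : \rho(x,y) < \infty\}$; a set is $E_\rho$-invariant if it is a union of $E_\rho$-classes. An equivalence relation is uniformly bounded if there is a finite uniform bound on the $\rho$-diameters of its classes. For a standard Borel space $Y$ with Borel extended metric $\rho$ such that every $E_\rho$-class is countable, $\mathrm{asdim}_{\mathbf{B}}(Y,\rho)$ is the least $d \in \mathbb{N}$ such that for every $r>0$ there is a uniformly bounded Borel equivalence relation $E$ on $Y$ such that for every $y\in Y$ the ball $B(y;r)$ meets at most $d+1$ classes of $E$; it is $\infty$ if no such $d$ exists. The standard asymptotic dimension $\mathrm{asdim}(Y,\rho)$ is defined in the same way but without requiring $E$ to be Borel. *)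

theory Defs
  imports "HOL-Analysis.Analysis" "HOL-Library.Extended_Nat"
begin

text \<open>
  Extended metrics take values in \<^typ>\<open>ennreal\<close>. Every notion is relative to a carrier set \<open>Y\<close>,
  so that restricting the metric to a subset just means changing the carrier.
\<close>

definition ext_metric_on :: "'a set \<Rightarrow> ('a \<Rightarrow> 'a \<Rightarrow> ennreal) \<Rightarrow> bool" where
  "ext_metric_on Y \<rho> \<longleftrightarrow>
     (\<forall>x\<in>Y. \<forall>y\<in>Y. \<rho> x y = 0 \<longleftrightarrow> x = y) \<and>
     (\<forall>x\<in>Y. \<forall>y\<in>Y. \<rho> x y = \<rho> y x) \<and>
     (\<forall>x\<in>Y. \<forall>y\<in>Y. \<forall>z\<in>Y. \<rho> x z \<le> \<rho> x y + \<rho> y z)"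

definition rho_ball :: "'a set \<Rightarrow> ('a \<Rightarrow> 'a \<Rightarrow> ennreal) \<Rightarrow> 'a \<Rightarrow> real \<Rightarrow> 'a set" where
  "rho_ball Y \<rho> x r = {y \<in> Y. \<rho> x y \<le> ennreal r}"

definition proper_on :: "'a set \<Rightarrow> ('a \<Rightarrow> 'a \<Rightarrow> ennreal) \<Rightarrow> bool" where
  "proper_on Y \<rho> \<longleftrightarrow> (\<forall>x\<in>Y. \<forall>r. finite (rho_ball Y \<rho> x r))"

definition finite_dist_rel :: "'a set \<Rightarrow> ('a \<Rightarrow> 'a \<Rightarrow> ennreal) \<Rightarrow> ('a \<times> 'a) set" where
  "finite_dist_rel Y \<rho> = {(x, y). x \<in> Y \<and> y \<in> Y \<and> \<rho> x y < \<infinity>}"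

definition rel_invariant :: "'a set \<Rightarrow> ('a \<times> 'a) set \<Rightarrow> 'a set \<Rightarrow> bool" where
  "rel_invariant Y E A \<longleftrightarrow> (\<exists>\<C> \<subseteq> Y // E. A = \<Union>\<C>)"

definition rho_diameter :: "('a \<Rightarrow> 'a \<Rightarrow> ennreal) \<Rightarrow> 'a set \<Rightarrow> ennreal" where
  "rho_diameter \<rho> C = (SUP x\<in>C. SUP y\<in>C. \<rho> x y)"

definition uniformly_bounded :: "'a set \<Rightarrow> ('a \<Rightarrow> 'a \<Rightarrow> ennreal) \<Rightarrow> ('a \<times> 'a) set \<Rightarrow> bool" where
  "uniformly_bounded Y \<rho> E \<longleftrightarrow> (\<exists>K::real. \<forall>C \<in> Y // E. rho_diameter \<rho> C \<le> ennreal K)"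

text \<open>
  \<open>asdim_among \<R> Y \<rho>\<close> is the common scheme behind both asymptotic dimensions: the witnessing
  equivalence relations are required to belong to \<open>\<R>\<close>. The explicit finiteness
  conjunct is needed because \<^const>\<open>card\<close> of an infinite set is \<open>0\<close>.
\<close>

definition asdim_bound ::
  "('a \<times> 'a) set set \<Rightarrow> 'a set \<Rightarrow> ('a \<Rightarrow> 'a \<Rightarrow> ennreal) \<Rightarrow> nat \<Rightarrow> bool" where
  "asdim_bound \<R> Y \<rho> d \<longleftrightarrow>
     (\<forall>r::real. r > 0 \<longrightarrow>
       (\<exists>E\<in>\<R>. equiv Y E \<and> uniformly_bounded Y \<rho> E \<and>
         (\<forall>y\<in>Y. finite {C \<in> Y // E. C \<inter> rho_ball Y \<rho> y r \<noteq> {}} \<and>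
                card {C \<in> Y // E. C \<inter> rho_ball Y \<rho> y r \<noteq> {}} \<le> d + 1)))"

definition asdim_among ::
  "('a \<times> 'a) set set \<Rightarrow> 'a set \<Rightarrow> ('a \<Rightarrow> 'a \<Rightarrow> ennreal) \<Rightarrow> enat" where
  "asdim_among \<R> Y \<rho> =
     (if \<exists>d. asdim_bound \<R> Y \<rho> d then enat (LEAST d. asdim_bound \<R> Y \<rho> d) else \<infinity>)"

definition asdim :: "'a set \<Rightarrow> ('a \<Rightarrow> 'a \<Rightarrow> ennreal) \<Rightarrow> enat" where
  "asdim Y \<rho> = asdim_among UNIV Y \<rho>"

text \<open>
  The Borel structure of the space is given by the \<open>\<sigma>\<close>-algebra of the measure \<open>M\<close> on \<^term>\<open>space M\<close>
  (its measure values play no role); a relation is Borel if it lies in the product \<open>\<sigma>\<close>-algebra.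
\<close>

definition asdim_Borel :: "'a measure \<Rightarrow> ('a \<Rightarrow> 'a \<Rightarrow> ennreal) \<Rightarrow> enat" where
  "asdim_Borel M \<rho> = asdim_among (sets (M \<Otimes>\<^sub>M M)) (space M) \<rho>"

definition nowhere_dense :: "'a::topological_space set \<Rightarrow> bool" where
  "nowhere_dense A \<longleftrightarrow> interior (closure A) = {}"

definition meager :: "'a::topological_space set \<Rightarrow> bool" where
  "meager A \<longleftrightarrow> (\<exists>N :: nat \<Rightarrow> 'a set. (\<forall>n. nowhere_dense (N n)) \<and> A = (\<Union>n. N n))"

definition comeager :: "'a::topological_space set \<Rightarrow> bool" where
  "comeager A \<longleftrightarrow> meager (- A)"

end

(*
  Lusin-Novikov uniformization (via Novikov separation of analytic sets) yields Borel functions f_n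
  with {y. rho x y < infinity} = {f_n x : n}, so Borelness is preserved by quantification over classes.
  A Baire category argument yields, for every scale t, sets A_n that are g_n-sparse for a prescribed
  rapidly growing g and whose union contains every class of a comeager invariant set. The A_n seed a
  toast of finite pieces, whose inner boundaries U and the complement of U both have finite
  t-components. If asdim X <= d, colourings by d + 1 colours whose monochromatic s-chains are
  D-bounded exist; on finite components they can be selected in a Borel way. Using scale s with bound
  D on U and scale D + 2s off U, the two Borel colourings fit together: a chain that leaves a
  monochromatic piece off U returns to the same piece. So asdim_B X <= d.
*)
theory Submission
  imports Defs
begin

text \<open>The obstacle is selection. Asymptotic dimension at most \<open>d\<close> supplies a
  colouring that need not be Borel, and an infinite component offers no evident Borel way to choose
  one. On a finite component every colouring is named by a natural number, so taking the least valid
  name is a Borel choice. The finite components cut out by the toast have no uniform bound on their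
  size. This is harmless: the uniform bounds \<open>D\<close> and \<open>D1\<close> come from the
  classical colourings of the whole of \<open>X\<close>, and finiteness serves the selection only.
  Category enters at one point. For each \<open>n\<close> the space is a countable union of
  \<open>g n\<close>-sparse Borel sets, but a single sequence, one set for each \<open>n\<close>,
  has to catch whole classes; this is achieved off a meager set. The growth
  \<open>sparse_gap\<close> depends only on the scale and on \<open>n\<close>, so it can be fixed
  before the sets are chosen. Covers are needed at every scale, because \<open>D + 2s\<close>
  involves the bound \<open>D\<close>, which is known only after the first colouring. Integer scales
  suffice, so \<open>X\<close> is one countable intersection.\<close>

section \<open>Separation of analytic sets\<close>

text \<open>
  Sequences over \<open>'a \<times> real\<close> play the role of the Baire space: the factor \<open>'a\<close> parametrizes
  the closed subsets of \<open>'a\<close> directly, and the real coordinates carry the index of a countable union.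
\<close>

definition closed_param :: "'a::{complete_space,second_countable_topology} set \<Rightarrow> bool" where
  "closed_param B \<longleftrightarrow>
     (\<exists>(S :: (nat \<Rightarrow> 'a \<times> real) set) f. closed S \<and> continuous_on S f \<and> f ` S = B)"

lemma continuous_on_coord: "continuous_on UNIV (\<lambda>s::nat \<Rightarrow> 'a::topological_space. s n)"
  by simp

lemma continuous_on_subseq:
  "continuous_on UNIV (\<lambda>(s::nat \<Rightarrow> 'a::topological_space) k. s (h k))"
  by (rule continuous_on_coordinatewise_then_product) simp

lemma closed_imp_closed_param:
  fixes B :: "'a::{complete_space,second_countable_topology} set"
  assumes "closed B"
  shows "closed_param B"
proof -
  define f :: "(nat \<Rightarrow> 'a \<times> real) \<Rightarrow> 'a" where "f s = fst (s 0)" for s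
  have cont: "continuous_on UNIV f"
    unfolding f_def by (intro continuous_on_fst continuous_on_coord)
  have "closed (f -` B)"
    by (rule closed_vimage[OF assms cont])
  moreover have "continuous_on (f -` B) f"
    using cont by (rule continuous_on_subset) simp
  moreover have "f ` (f -` B) = B"
  proof -
    have "b \<in> range f" for b
      by (rule range_eqI[of _ _ "\<lambda>_. (b, 0)"]) (simp add: f_def)
    then show ?thesis by auto
  qed
  ultimately show ?thesis
    unfolding closed_param_def by blast
qed

text \<open>A disjoint sum of the parameter spaces: the real component of the first entry records
  the index \<open>n\<close>, and the shifted sequence runs through \<open>S n\<close>.\<close>

lemma closed_param_UN:
  fixes B :: "nat \<Rightarrow> 'a::{complete_space,second_countable_topology} set"
  assumes "\<And>n. closed_param (B n)"
  shows "closed_param (\<Union>n. B n)"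
proof -
  have "\<forall>n. \<exists>(S :: (nat \<Rightarrow> 'a \<times> real) set) f. closed S \<and> continuous_on S f \<and> f ` S = B n"
    using assms unfolding closed_param_def by blast
  then obtain S :: "nat \<Rightarrow> (nat \<Rightarrow> 'a \<times> real) set" and f
    where S: "\<And>n. closed (S n)" and f: "\<And>n. continuous_on (S n) (f n)"
      and img: "\<And>n. f n ` S n = B n"
    by metis
  define h :: "(nat \<Rightarrow> 'a \<times> real) \<Rightarrow> real" where "h s = snd (s 0)" for s
  define sh :: "(nat \<Rightarrow> 'a \<times> real) \<Rightarrow> nat \<Rightarrow> 'a \<times> real" where "sh s = (\<lambda>k. s (Suc k))" for s
  \<comment> \<open>Being a sum over all \<open>n\<close> is rewritten as an intersection of closed
    conditions: since \<open>h s\<close> is a natural number, distance below 1 from \<open>n\<close>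
    means that it equals \<open>n\<close>.\<close>
  define T where "T = {s. h s \<in> \<nat>} \<inter> (\<Inter>n. {s. \<bar>h s - real n\<bar> \<ge> 1} \<union> {s. sh s \<in> S n})"
  define g where "g s = f (nat \<lfloor>h s\<rfloor>) (sh s)" for s
  have h: "continuous_on UNIV h"
    unfolding h_def by (intro continuous_on_snd continuous_on_coord)
  have sh: "continuous_on UNIV sh"
    unfolding sh_def by (rule continuous_on_subseq)
  have T_iff: "s \<in> T \<longleftrightarrow> (\<exists>n. h s = real n \<and> sh s \<in> S n)" for s
  proof
    assume "s \<in> T"
    then obtain n where "h s = real n" unfolding T_def Nats_def by auto
    moreover from \<open>s \<in> T\<close> have "\<bar>h s - real n\<bar> \<ge> 1 \<or> sh s \<in> S n" unfolding T_def by blast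
    ultimately show "\<exists>n. h s = real n \<and> sh s \<in> S n" by auto
  next
    assume "\<exists>n. h s = real n \<and> sh s \<in> S n"
    then obtain n where n: "h s = real n" "sh s \<in> S n" by blast
    have "\<bar>h s - real m\<bar> \<ge> 1 \<or> sh s \<in> S m" for m
      using n by (cases "m = n") (auto simp: abs_if)
    then show "s \<in> T" using n unfolding T_def by auto
  qed
  have "closed T"
    unfolding T_def
  proof (intro closed_Int closed_INT ballI closed_Un)
    show "closed {s. h s \<in> \<nat>}"
      using closed_vimage[OF closed_Nats h] by (simp add: vimage_def)
    show "closed {s. 1 \<le> \<bar>h s - real n\<bar>}" for n
      by (intro closed_Collect_le continuous_intros h)
    show "closed {s. sh s \<in> S n}" for n
      using closed_vimage[OF S sh] by (simp add: vimage_def)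
  qed
  moreover have "continuous_on T g"
    unfolding continuous_on_eq_continuous_within
  proof
    fix s assume "s \<in> T"
    then obtain n where n: "h s = real n" "sh s \<in> S n" using T_iff by blast
    \<comment> \<open>The recorded index is locally constant on \<open>T\<close>: on this
      neighbourhood it is \<open>n\<close>, so \<open>g\<close> agrees there with one continuous
      map.\<close>
    define U where "U = {u. \<bar>h u - real n\<bar> < 1}"
    have "open U" unfolding U_def by (intro open_Collect_less continuous_intros h)
    have eq: "h u = real n \<and> sh u \<in> S n" if u: "u \<in> T \<inter> U" for u
    proof -
      from u obtain m where "h u = real m" "sh u \<in> S m" using T_iff by blast
      moreover have "m = n" using u \<open>h u = real m\<close> by (auto simp: U_def abs_less_iff)
      ultimately show ?thesis by simp
    qed
    have "continuous_on (T \<inter> U) (\<lambda>u. f n (sh u))"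
      by (rule continuous_on_compose2[OF f[of n] continuous_on_subset[OF sh]]) (use eq in auto)
    then have "continuous_on (T \<inter> U) g"
      by (rule continuous_on_eq) (simp add: g_def eq)
    then have "continuous (at s within (T \<inter> U)) g"
      using \<open>s \<in> T\<close> n by (simp add: continuous_on_eq_continuous_within U_def)
    moreover have "at s within T = at s within (T \<inter> U)"
      by (rule at_within_nhd[of _ U]) (use \<open>open U\<close> n in \<open>auto simp: U_def\<close>)
    ultimately show "continuous (at s within T) g" by simp
  qed
  moreover have "g ` T = (\<Union>n. B n)"
  proof (rule set_eqI, rule iffI)
    fix b assume "b \<in> g ` T"
    then obtain s n where "b = g s" "h s = real n" "sh s \<in> S n" using T_iff by blast
    then show "b \<in> (\<Union>n. B n)" using img[of n] by (auto simp: g_def)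
  next
    fix b assume "b \<in> (\<Union>n. B n)"
    then obtain n where "b \<in> f n ` S n" using img by blast
    then obtain t where t: "t \<in> S n" "b = f n t" by blast
    define s where "s = (\<lambda>k. case k of 0 \<Rightarrow> (undefined, real n) | Suc j \<Rightarrow> t j)"
    have "h s = real n" "sh s = t" by (auto simp: h_def sh_def s_def)
    then have "s \<in> T" "g s = b" using t T_iff by (auto simp: g_def)
    then show "b \<in> g ` T" by blast
  qed
  ultimately show ?thesis unfolding closed_param_def by blast
qed

text \<open>A countable fibre product: one sequence interleaves parameters for all
  \<open>B n\<close> through \<open>prod_encode\<close>, and the closed condition
  \<open>d n s = 0\<close> makes all of them name the same point.\<close>

lemma closed_param_INT:
  fixes B :: "nat \<Rightarrow> 'a::{complete_space,second_countable_topology} set"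
  assumes "\<And>n. closed_param (B n)"
  shows "closed_param (\<Inter>n. B n)"
proof -
  have "\<forall>n. \<exists>(S :: (nat \<Rightarrow> 'a \<times> real) set) f. closed S \<and> continuous_on S f \<and> f ` S = B n"
    using assms unfolding closed_param_def by blast
  then obtain S :: "nat \<Rightarrow> (nat \<Rightarrow> 'a \<times> real) set" and f
    where S: "\<And>n. closed (S n)" and f: "\<And>n. continuous_on (S n) (f n)"
      and img: "\<And>n. f n ` S n = B n"
    by metis
  define p :: "nat \<Rightarrow> (nat \<Rightarrow> 'a \<times> real) \<Rightarrow> nat \<Rightarrow> 'a \<times> real"
    where "p n s = (\<lambda>k. s (prod_encode (n, k)))" for n s
  define T where "T = (\<Inter>n. p n -` S n)"
  define d where "d n s = dist (f n (p n s)) (f 0 (p 0 s))" for n s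
  define T' where "T' = (\<Inter>n. T \<inter> d n -` {0})"
  have p: "continuous_on UNIV (p n)" for n
    unfolding p_def by (rule continuous_on_subseq)
  have "closed T"
    unfolding T_def using closed_vimage[OF S p] by blast
  have fp: "continuous_on T (\<lambda>s. f n (p n s))" for n
    by (rule continuous_on_compose2[OF f[of n] continuous_on_subset[OF p]]) (auto simp: T_def)
  have "closed (T \<inter> d n -` {0})" for n
    unfolding d_def
    by (intro continuous_closed_preimage continuous_on_dist fp \<open>closed T\<close>) simp
  then have "closed T'" unfolding T'_def by blast
  moreover have "continuous_on T' (\<lambda>s. f 0 (p 0 s))"
    using fp[of 0] by (rule continuous_on_subset) (auto simp: T'_def)
  moreover have "(\<lambda>s. f 0 (p 0 s)) ` T' = (\<Inter>n. B n)"
  proof (rule set_eqI, rule iffI)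
    fix b assume "b \<in> (\<lambda>s. f 0 (p 0 s)) ` T'"
    then obtain s where s: "s \<in> T'" "b = f 0 (p 0 s)" by blast
    have "f n (p n s) = b \<and> p n s \<in> S n" for n
    proof -
      have "s \<in> T \<inter> d n -` {0}" using s(1) unfolding T'_def by blast
      then have "s \<in> T" "d n s = 0" by simp_all
      moreover have "p n s \<in> S n" using \<open>s \<in> T\<close> unfolding T_def by blast
      ultimately show ?thesis using s(2) by (simp add: d_def)
    qed
    then have "b \<in> f n ` S n" for n by (metis imageI)
    then show "b \<in> (\<Inter>n. B n)" by (simp add: img)
  next
    fix b assume "b \<in> (\<Inter>n. B n)"
    then have "b \<in> f n ` S n" for n by (simp add: img)
    then have "\<forall>n. \<exists>t. t \<in> S n \<and> f n t = b" by (metis imageE)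
    then obtain t where t: "\<And>n. t n \<in> S n" "\<And>n. f n (t n) = b" by metis
    define s where "s = (\<lambda>j. case prod_decode j of (n, k) \<Rightarrow> t n k)"
    have "p n s = t n" for n by (simp add: p_def s_def)
    then have "d n s = 0" for n using t(2) by (simp add: d_def)
    moreover have "s \<in> T" using \<open>\<And>n. p n s = t n\<close> t(1) by (simp add: T_def)
    ultimately have "s \<in> T'" by (simp add: T'_def)
    moreover have "f 0 (p 0 s) = b" using t(2) \<open>\<And>n. p n s = t n\<close> by simp
    ultimately show "b \<in> (\<lambda>s. f 0 (p 0 s)) ` T'" by blast
  qed
  ultimately show ?thesis unfolding closed_param_def by blast
qed

lemma open_imp_closed_param:
  fixes B :: "'a::{complete_space,second_countable_topology} set"
  assumes "open B"
  shows "closed_param B"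
proof -
  define F where "F n = (\<Inter>y\<in>-B. {x. inverse (real (Suc n)) \<le> dist x y})" for n
  have "closed (F n)" for n
    unfolding F_def by (intro closed_INT ballI closed_Collect_le continuous_intros)
  moreover have "B = (\<Union>n. F n)"
  proof (rule set_eqI, rule iffI)
    fix x assume "x \<in> B"
    then obtain e where e: "e > 0" "ball x e \<subseteq> B" using assms open_contains_ball by blast
    obtain n where "inverse (real (Suc n)) < e" using reals_Archimedean e(1) by blast
    have "inverse (real (Suc n)) \<le> dist x y" if "y \<in> - B" for y
    proof -
      have "e \<le> dist x y" using e(2) that by (meson ComplD mem_ball not_le subsetD)
      then show ?thesis using \<open>inverse (real (Suc n)) < e\<close> by linarith
    qed
    then have "x \<in> F n" by (simp add: F_def)
    then show "x \<in> (\<Union>n. F n)" by blast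
  next
    fix x assume "x \<in> (\<Union>n. F n)"
    then obtain n where "x \<in> F n" by blast
    then have "inverse (real (Suc n)) \<le> dist x x" if "x \<notin> B"
      using that unfolding F_def by blast
    then show "x \<in> B" by auto
  qed
  ultimately show ?thesis
    using closed_param_UN[of F] closed_imp_closed_param by metis
qed

text \<open>The set and its complement go through the induction together, because being a continuous
  image is not preserved by complements; countable unions and intersections exchange roles.\<close>

lemma borel_closed_param_compl:
  fixes B :: "'a::{complete_space,second_countable_topology} set"
  assumes "B \<in> sets borel"
  shows "closed_param B \<and> closed_param (- B)"
proof -
  have "B \<in> sigma_sets UNIV {S. open S}"
    using assms by (simp add: sets_borel)
  then show ?thesis
  proof induction
    case (Basic a)
    then show ?case by (simp add: open_imp_closed_param closed_imp_closed_param closed_Compl)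
  next
    case Empty
    then show ?case by (simp add: closed_imp_closed_param)
  next
    case (Compl a)
    then show ?case by (simp add: Compl_eq_Diff_UNIV[symmetric])
  next
    case (Union a)
    then show ?case by (simp add: closed_param_UN closed_param_INT)
  qed
qed

lemma borel_closed_param:
  fixes B :: "'a::{complete_space,second_countable_topology} set"
  assumes "B \<in> sets borel"
  shows "closed_param B"
  using borel_closed_param_compl[OF assms] by blast

lemma dense_sequence:
  obtains q :: "nat \<Rightarrow> 'a::{metric_space,second_countable_topology}"
  where "\<And>x e. e > 0 \<Longrightarrow> \<exists>j. dist (q j) x < e"
proof -
  obtain D :: "'a set" where D: "countable D" "\<And>X. open X \<Longrightarrow> X \<noteq> {} \<Longrightarrow> \<exists>d\<in>D. d \<in> X"
    using countable_dense_setE by blast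
  show ?thesis
  proof
    fix x :: 'a and e :: real assume "e > 0"
    then have "ball x e \<noteq> {}" by simp
    then have "\<exists>d\<in>D. d \<in> ball x e" by (rule D(2)[OF open_ball])
    then obtain d where d: "d \<in> D" "d \<in> ball x e" by blast
    obtain j where "from_nat_into D j = d"
      using from_nat_into_surj[OF D(1) \<open>d \<in> D\<close>] by blast
    then show "\<exists>j. dist (from_nat_into D j) x < e" using d(2) by (metis mem_ball dist_commute)
  qed
qed

section \<open>Novikov's separation theorem for countable families\<close>

definition borel_separated :: "(nat \<Rightarrow> 'a::topological_space set) \<Rightarrow> bool" where
  "borel_separated A \<longleftrightarrow>
     (\<exists>B. (\<forall>n. B n \<in> sets borel \<and> A n \<subseteq> B n) \<and> (\<Inter>n. B n) = {})"

text \<open>Unite the separators over \<open>j\<close> in coordinate \<open>n\<close> and intersect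
  them in all others. A common point picks some \<open>j\<close> in coordinate \<open>n\<close> and
  then lies in every \<open>B j i\<close>, which is impossible.\<close>

lemma borel_separated_split:
  assumes sep: "\<And>j::nat. borel_separated (A(n := P j))" and An: "A n = (\<Union>j. P j)"
  shows "borel_separated A"
proof -
  obtain B where B: "\<And>j i. B j i \<in> sets borel" "\<And>j i. (A(n := P j)) i \<subseteq> B j i"
      "\<And>j. (\<Inter>i. B j i) = {}"
    using sep unfolding borel_separated_def by metis
  define C where "C i = (if i = n then (\<Union>j. B j i) else (\<Inter>j. B j i))" for i
  have "C i \<in> sets borel" for i
    unfolding C_def using B(1) by auto
  moreover have "A i \<subseteq> C i" for i
  proof (cases "i = n")
    case True
    have "P j \<subseteq> B j n" for j using B(2)[of j n] by simp
    then show ?thesis using True An by (auto simp: C_def)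
  next
    case False
    have "A i \<subseteq> B j i" for j using B(2)[of j i] False by simp
    then show ?thesis using False by (auto simp: C_def)
  qed
  moreover have "(\<Inter>i. C i) = {}"
  proof (rule ccontr)
    assume "(\<Inter>i. C i) \<noteq> {}"
    then obtain z where z: "\<And>i. z \<in> C i" by blast
    then obtain j where "z \<in> B j n" using z[of n] by (auto simp: C_def)
    moreover have "z \<in> B j i" if "i \<noteq> n" for i using z[of i] that by (auto simp: C_def)
    ultimately have "z \<in> (\<Inter>i. B j i)" by (metis INT_I)
    then show False using B(3) by blast
  qed
  ultimately show ?thesis unfolding borel_separated_def by blast
qed

lemma borel_separated_empty:
  assumes "A n = {}"
  shows "borel_separated A"
  unfolding borel_separated_def
  by (rule exI[of _ "\<lambda>i. if i = n then {} else UNIV"]) (use assms in auto)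

lemma borel_separated_disjoint:
  assumes "open U" "open V" "U \<inter> V = {}" "A i \<subseteq> U" "A j \<subseteq> V" "i \<noteq> j"
  shows "borel_separated A"
  unfolding borel_separated_def
  by (rule exI[of _ "\<lambda>k. if k = i then U else if k = j then V else UNIV"])
     (use assms in \<open>auto split: if_splits\<close>)

text \<open>If separation fails, \<open>borel_separated_split\<close> keeps it failing while the
  domains shrink, one coordinate at a time, to points \<open>a n\<close>. As the images have no
  common point, two of the limits have different values; disjoint neighbourhoods of these values
  separate a late stage.\<close>

theorem novikov_separation:
  fixes f :: "nat \<Rightarrow> 'w::{complete_space,second_countable_topology} \<Rightarrow> 'z::t2_space"
  assumes S: "\<And>n. closed (S n)" and f: "\<And>n. continuous_on (S n) (f n)"
    and empty: "(\<Inter>n. f n ` S n) = {}"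
  shows "borel_separated (\<lambda>n. f n ` S n)"
proof (rule ccontr)
  assume nsep: "\<not> borel_separated (\<lambda>n. f n ` S n)"
  obtain q :: "nat \<Rightarrow> 'w" where q: "\<And>x e. e > 0 \<Longrightarrow> \<exists>j. dist (q j) x < e"
    using dense_sequence by blast
  define P where "P R \<longleftrightarrow> (\<forall>n. closed (R n) \<and> R n \<subseteq> S n) \<and> \<not> borel_separated (\<lambda>n. f n ` R n)" for R
  \<comment> \<open>Step \<open>k\<close> shrinks the first component of
    \<open>prod_decode k\<close>, so every coordinate is treated infinitely often, with radii
    tending to 0.\<close>
  define Q where "Q k R R' \<longleftrightarrow> (\<forall>n. R' n \<subseteq> R n) \<and>
    (\<exists>c. R' (fst (prod_decode k)) \<subseteq> cball c (inverse (real (Suc k))))" for k and R R' :: "nat \<Rightarrow> 'w set"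
  have "\<exists>R. \<forall>k. P (R k) \<and> Q k (R k) (R (Suc k))"
  proof (rule dependent_nat_choice)
    show "\<exists>R. P R" using S nsep unfolding P_def by (intro exI[of _ S]) simp
  next
    fix R k assume PR: "P R"
    define n where "n = fst (prod_decode k)"
    define R' where "R' j = R(n := R n \<inter> cball (q j) (inverse (real (Suc k))))" for j
    have "R n = (\<Union>j. R n \<inter> cball (q j) (inverse (real (Suc k))))"
    proof -
      have "\<exists>j. x \<in> cball (q j) (inverse (real (Suc k)))" for x
        using q[of "inverse (real (Suc k))" x] by (auto intro: less_imp_le)
      then show ?thesis by blast
    qed
    then have "f n ` R n = (\<Union>j. f n ` R' j n)"
      unfolding R'_def by (simp add: image_UN[symmetric])
    then obtain j where "\<not> borel_separated ((\<lambda>n. f n ` R n)(n := f n ` R' j n))"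
      using borel_separated_split[of "\<lambda>n. f n ` R n" n "\<lambda>j. f n ` R' j n"] PR
      unfolding P_def by blast
    moreover have "(\<lambda>n. f n ` R n)(n := f n ` R' j n) = (\<lambda>i. f i ` R' j i)"
      by (rule ext) (simp add: R'_def)
    ultimately have "P (R' j)"
      using PR unfolding P_def by (auto simp: R'_def)
    moreover have "Q k R (R' j)"
      unfolding Q_def n_def[symmetric] by (auto simp: R'_def)
    ultimately show "\<exists>R'. P R' \<and> Q k R R'" by blast
  qed
  then obtain R where P: "\<And>k. P (R k)" and Q: "\<And>k. Q k (R k) (R (Suc k))" by blast
  have mono: "R l n \<subseteq> R k n" if "k \<le> l" for k l n
    using lift_Suc_antimono_le[of "\<lambda>k. R k n", OF _ that] Q unfolding Q_def by blast
  have small: "\<exists>k. \<forall>x\<in>R k n. \<forall>y\<in>R k n. dist x y < e" if e: "e > 0" for e n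
  proof -
    obtain N where N: "inverse (real (Suc N)) < e / 2"
      using reals_Archimedean e half_gt_zero by blast
    \<comment> \<open>A step that treats coordinate \<open>n\<close> and comes no earlier than
      \<open>N\<close>, so that its radius is already below \<open>e / 2\<close>.\<close>
    define k where "k = prod_encode (n, N)"
    have "N \<le> k" unfolding k_def by (rule le_prod_encode_2)
    then have "inverse (real (Suc k)) < e / 2"
      using N by (meson inverse_le_iff_le le_less_trans of_nat_0_less_iff of_nat_mono Suc_le_mono zero_less_Suc)
    moreover obtain c where "R (Suc k) n \<subseteq> cball c (inverse (real (Suc k)))"
      using Q[of k] unfolding Q_def k_def by auto
    ultimately have c: "dist c x < e / 2" if "x \<in> R (Suc k) n" for x
      using that by (force simp: subset_iff)
    show ?thesis
    proof (intro exI ballI)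
      fix x y assume "x \<in> R (Suc k) n" "y \<in> R (Suc k) n"
      then have "dist c x < e / 2" "dist c y < e / 2" using c by auto
      then show "dist x y < e" by (metis dist_commute dist_triangle_half_l)
    qed
  qed
  have ne: "R k n \<noteq> {}" for k n
    using P[of k] borel_separated_empty[of "\<lambda>n. f n ` R k n" n] unfolding P_def by auto
  have "\<exists>a. \<forall>k. a \<in> R k n" for n
    using decreasing_closed_nest[of "\<lambda>k. R k n"] ne mono small P unfolding P_def by metis
  then obtain a where a: "\<And>n k. a n \<in> R k n" by metis
  have aS: "a n \<in> S n" for n using a P unfolding P_def by blast
  have "\<exists>i. f i (a i) \<noteq> f 0 (a 0)"
  proof (rule ccontr)
    assume "\<nexists>i. f i (a i) \<noteq> f 0 (a 0)"
    then have "f 0 (a 0) \<in> f n ` S n" for n using aS by (metis imageI)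
    then show False using empty by blast
  qed
  then obtain i where i: "f i (a i) \<noteq> f 0 (a 0)" by blast
  obtain U V where UV: "open U" "open V" "f i (a i) \<in> U" "f 0 (a 0) \<in> V" "U \<inter> V = {}"
    using hausdorff[OF i] by blast
  have near: "\<exists>k. f n ` R k n \<subseteq> W" if W: "open W" "f n (a n) \<in> W" for n W
  proof -
    obtain X where X: "open X" "X \<inter> S n = f n -` W \<inter> S n"
      using f[of n, unfolded continuous_on_open_invariant, rule_format, OF W(1)] by blast
    have "a n \<in> f n -` W \<inter> S n" using aS W(2) by simp
    then have "a n \<in> X" using X(2) by blast
    then obtain e where e: "e > 0" "ball (a n) e \<subseteq> X" using X(1) open_contains_ball by blast
    then obtain k where "\<forall>x\<in>R k n. \<forall>y\<in>R k n. dist x y < e" using small by blast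
    then have "R k n \<subseteq> X" using a e(2) by (auto simp: subset_iff)
    moreover have "R k n \<subseteq> S n" using P unfolding P_def by blast
    ultimately have "R k n \<subseteq> f n -` W" using X(2) by blast
    then show ?thesis by blast
  qed
  obtain k l where "f i ` R k i \<subseteq> U" "f 0 ` R l 0 \<subseteq> V"
    using near[OF UV(1,3)] near[OF UV(2,4)] by blast
  then have "f i ` R (max k l) i \<subseteq> U" "f 0 ` R (max k l) 0 \<subseteq> V"
    by (meson image_mono max.cobounded1 max.cobounded2 mono order_trans)+
  moreover have "i \<noteq> 0" using i by metis
  ultimately have "borel_separated (\<lambda>n. f n ` R (max k l) n)"
    using borel_separated_disjoint[of U V "\<lambda>n. f n ` R (max k l) n" i 0] UV by simp
  then show False using P unfolding P_def by blast
qed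

section \<open>Uniformization of Borel sets with finite sections\<close>

text \<open>The sets \<open>Q n\<close> need not be Borel; only the sets \<open>P - Q n\<close> are
  known to be analytic, and they have empty intersection because the \<open>Q n\<close> cover
  \<open>P\<close>. Removing their Novikov separators from \<open>P\<close> leaves Borel sets inside
  the \<open>Q n\<close> that still cover.\<close>

lemma borel_reduction:
  fixes g :: "nat \<Rightarrow> 'y::{complete_space,second_countable_topology} \<Rightarrow> 'z::t2_space"
  assumes P: "P \<in> sets borel" and Q: "P \<subseteq> (\<Union>n. Q n)"
    and B: "\<And>n. B n \<in> sets borel" and g: "\<And>n. continuous_on UNIV (g n)"
    and img: "\<And>n. g n ` B n = P - Q n"
  obtains C where "\<And>n::nat. C n \<in> sets borel" "\<And>n. C n \<subseteq> Q n" "P = (\<Union>n. C n)"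
proof -
  have "\<forall>n. \<exists>(S :: (nat \<Rightarrow> 'y \<times> real) set) h. closed S \<and> continuous_on S h \<and> h ` S = B n"
    using borel_closed_param[OF B] unfolding closed_param_def by blast
  then obtain S :: "nat \<Rightarrow> (nat \<Rightarrow> 'y \<times> real) set" and h
    where S: "\<And>n. closed (S n)" and h: "\<And>n. continuous_on (S n) (h n)" and hB: "\<And>n. h n ` S n = B n"
    by metis
  have eq: "(g n \<circ> h n) ` S n = P - Q n" for n
    by (metis hB img image_comp)
  have "borel_separated (\<lambda>n. (g n \<circ> h n) ` S n)"
  proof (rule novikov_separation[OF S])
    show "continuous_on (S n) (g n \<circ> h n)" for n
      by (rule continuous_on_compose[OF h continuous_on_subset[OF g]]) simp
    show "(\<Inter>n. (g n \<circ> h n) ` S n) = {}"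
      unfolding eq using Q by blast
  qed
  then obtain D where D: "\<And>n. D n \<in> sets borel" "\<And>n. P - Q n \<subseteq> D n" "(\<Inter>n. D n) = {}"
    unfolding borel_separated_def eq by blast
  show ?thesis
  proof
    show "P - D n \<in> sets borel" for n using P D(1) by (rule sets.Diff)
    show "P - D n \<subseteq> Q n" for n using D(2)[of n] by blast
    show "P = (\<Union>n. P - D n)" using D(3) by blast
  qed
qed

text \<open>The condition that \<open>q j\<close> is \<open>e\<close>-close to the value at
  \<open>x\<close> is coanalytic in \<open>x\<close>, so \<open>borel_reduction\<close> makes the
  choice of \<open>j\<close> Borel. The resulting approximations converge to the value.\<close>

lemma borel_function_of_single_valued:
  fixes C :: "('a::{complete_space,second_countable_topology} \<times> 'b::{complete_space,second_countable_topology}) set"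
  assumes C: "C \<in> sets borel" and single: "\<And>x y y'. (x, y) \<in> C \<Longrightarrow> (x, y') \<in> C \<Longrightarrow> y = y'"
  shows "\<exists>g\<in>borel_measurable borel. \<forall>x y. (x, y) \<in> C \<longrightarrow> g x = y"
proof -
  obtain q :: "nat \<Rightarrow> 'b" where q: "\<And>x e. e > 0 \<Longrightarrow> \<exists>j. dist (q j) x < e"
    using dense_sequence by blast
  have "\<exists>h\<in>borel_measurable borel. \<forall>x y. (x, y) \<in> C \<longrightarrow> dist (h x) y < e" if e: "e > 0" for e
  proof -
    define Q where "Q j = {x. \<forall>y. (x, y) \<in> C \<longrightarrow> dist (q j) y < e}" for j
    define B where "B j = C \<inter> {p. e \<le> dist (q j) (snd p)}" for j
    have "closed {p :: 'a \<times> 'b. e \<le> dist (q j) (snd p)}" for j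
      by (intro closed_Collect_le continuous_intros)
    then have B: "B j \<in> sets borel" for j
      unfolding B_def using C by (intro sets.Int) auto
    have cover: "UNIV \<subseteq> (\<Union>j. Q j)"
    proof
      fix x
      show "x \<in> (\<Union>j. Q j)"
      proof (cases "\<exists>y. (x, y) \<in> C")
        case True
        then obtain y where y: "(x, y) \<in> C" by blast
        obtain j where "dist (q j) y < e" using q[OF e] by blast
        then have "x \<in> Q j" using y single unfolding Q_def by blast
        then show ?thesis by blast
      next
        \<comment> \<open>Where there is no value the condition is vacuous, so the sets
          \<open>Q j\<close> cover the whole space and \<open>h\<close> is total.\<close>
        case False
        then have "x \<in> Q 0" unfolding Q_def by blast
        then show ?thesis by blast
      qed
    qed
    have img: "fst ` B j = UNIV - Q j" for j
      unfolding B_def Q_def by (force simp: not_less)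
    obtain S where S: "\<And>n. S n \<in> sets borel" "\<And>n. S n \<subseteq> Q n" "UNIV = (\<Union>n. S n)"
      by (rule borel_reduction[of UNIV Q B "\<lambda>_. fst"]) (use cover B img in \<open>auto intro: continuous_on_fst\<close>)
    define h where "h x = q (LEAST j. x \<in> S j)" for x
    have "(\<lambda>x. LEAST j. x \<in> S j) \<in> measurable borel (count_space UNIV)"
      by (rule measurable_Least) (use S(1) in simp)
    then have "h \<in> borel_measurable borel"
      unfolding h_def by (rule measurable_compose) simp
    moreover have "dist (h x) y < e" if "(x, y) \<in> C" for x y
    proof -
      have "\<exists>j. x \<in> S j" using S(3) by blast
      then have "x \<in> S (LEAST j. x \<in> S j)" by (rule LeastI_ex)
      then have "x \<in> Q (LEAST j. x \<in> S j)" using S(2) by blast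
      then show ?thesis using that unfolding Q_def h_def by blast
    qed
    ultimately show ?thesis by blast
  qed
  then have "\<forall>m::nat. \<exists>h\<in>borel_measurable borel. \<forall>x y. (x, y) \<in> C \<longrightarrow> dist (h x) y < inverse (real (Suc m))"
    by simp
  then obtain h where h[measurable]: "\<And>m. h m \<in> borel_measurable borel"
      and near: "\<And>m x y. (x, y) \<in> C \<Longrightarrow> dist (h m x) y < inverse (real (Suc m))"
    by metis
  \<comment> \<open>Sequences that are not Cauchy are replaced by a constant one, so that the limit
    exists everywhere; this happens only at points without a value.\<close>
  define u where "u m x = (if Cauchy (\<lambda>m. h m x) then h m x else q 0)" for m x
  define g where "g x = lim (\<lambda>m. u m x)" for x
  have conv: "convergent (\<lambda>m. u m x)" for x
    unfolding u_def by (cases "Cauchy (\<lambda>m. h m x)") (auto simp: Cauchy_convergent_iff convergent_const)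
  have "g \<in> borel_measurable borel"
  proof (rule borel_measurable_LIMSEQ_metric)
    show "u m \<in> borel_measurable borel" for m
      unfolding u_def by measurable
    show "(\<lambda>m. u m x) \<longlonglongrightarrow> g x" for x
      unfolding g_def using conv by (simp add: convergent_LIMSEQ_iff)
  qed
  moreover have "g x = y" if "(x, y) \<in> C" for x y
  proof -
    have lim: "(\<lambda>m. h m x) \<longlonglongrightarrow> y"
    proof (rule metric_tendsto_imp_tendsto)
      show "(\<lambda>m. inverse (real (Suc m))) \<longlonglongrightarrow> 0" by (rule LIMSEQ_inverse_real_of_nat)
      show "\<forall>\<^sub>F m in sequentially. dist (h m x) y \<le> dist (inverse (real (Suc m))) 0"
        using near[OF that] by (intro always_eventually allI) (simp add: less_imp_le del: of_nat_Suc)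
    qed
    then have "u m x = h m x" for m unfolding u_def using LIMSEQ_imp_Cauchy by auto
    then show ?thesis using lim unfolding g_def by (simp add: limI)
  qed
  ultimately show ?thesis by blast
qed

lemma countable_base_sequence:
  obtains V :: "nat \<Rightarrow> 'a::second_countable_topology set"
  where "\<And>k. open (V k)" "\<And>x U. open U \<Longrightarrow> x \<in> U \<Longrightarrow> \<exists>k. x \<in> V k \<and> V k \<subseteq> U"
proof -
  obtain B :: "'a set set" where B: "countable B" "topological_basis B"
    using ex_countable_basis by blast
  have ne: "B \<noteq> {}" using topological_basisE[OF B(2) open_UNIV UNIV_I] by blast
  show ?thesis
  proof
    show "open (from_nat_into B k)" for k
      by (rule topological_basis_open[OF B(2) from_nat_into[OF ne]])
    fix x :: 'a and U assume "open U" "x \<in> U"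
    then obtain W where W: "W \<in> B" "x \<in> W" "W \<subseteq> U" using topological_basisE[OF B(2)] by blast
    obtain k where "from_nat_into B k = W" using from_nat_into_surj[OF B(1) W(1)] by blast
    then show "\<exists>k. x \<in> from_nat_into B k \<and> from_nat_into B k \<subseteq> U" using W by blast
  qed
qed

text \<open>The common use of finiteness: a basic open set can be named by a natural number and
  singles out a point of a finite set. Uniformization, sparse covers and colour codes all rest on
  it.\<close>

lemma base_isolates_finite:
  fixes V :: "nat \<Rightarrow> 'a::t1_space set"
  assumes V: "\<And>x U. open U \<Longrightarrow> x \<in> U \<Longrightarrow> \<exists>k. x \<in> V k \<and> V k \<subseteq> U" and F: "finite F"
  shows "\<exists>k. x \<in> V k \<and> V k \<inter> F \<subseteq> {x}"
proof -
  have "open (- (F - {x}))" using F by (intro open_Compl finite_imp_closed) simp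
  then obtain k where "x \<in> V k" "V k \<subseteq> - (F - {x})" using V[of "- (F - {x})" x] by blast
  then show ?thesis by blast
qed

text \<open>The pieces \<open>Q k\<close> collect the pairs whose second point is isolated in its
  section by \<open>V k\<close>. They are single-valued, and finiteness of the sections makes them
  cover \<open>P\<close>; \<open>borel_reduction\<close> replaces them by Borel pieces.\<close>

theorem borel_finite_sections_uniformization:
  fixes P :: "('a::{complete_space,second_countable_topology} \<times> 'b::{complete_space,second_countable_topology}) set"
  assumes P: "P \<in> sets borel" and fin: "\<And>x. finite {y. (x, y) \<in> P}"
  obtains g :: "nat \<Rightarrow> 'a \<Rightarrow> 'b"
  where "\<And>n. g n \<in> borel_measurable borel" "\<And>x y. (x, y) \<in> P \<Longrightarrow> \<exists>n. g n x = y"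
proof -
  obtain V :: "nat \<Rightarrow> 'b set" where V: "\<And>k. open (V k)"
      "\<And>x U. open U \<Longrightarrow> x \<in> U \<Longrightarrow> \<exists>k. x \<in> V k \<and> V k \<subseteq> U"
    using countable_base_sequence by blast
  define Q where "Q k = {(x, y). y \<in> V k \<and>
    (\<forall>y' y''. (x, y') \<in> P \<longrightarrow> (x, y'') \<in> P \<longrightarrow> y' \<in> V k \<longrightarrow> y'' \<in> V k \<longrightarrow> y' = y'')}" for k
  \<comment> \<open>Failure of isolation is witnessed by two distinct section points in
    \<open>V k\<close>; keeping the witnesses as extra coordinates makes the condition Borel and
    \<open>P - Q k\<close> its projection.\<close>
  define B :: "nat \<Rightarrow> (('a \<times> 'b) \<times> ('b \<times> 'b)) set" where
    "B k = {p. fst p \<in> P \<and> (snd (fst p) \<notin> V k \<or>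
      ((fst (fst p), fst (snd p)) \<in> P \<and> (fst (fst p), snd (snd p)) \<in> P \<and>
       fst (snd p) \<in> V k \<and> snd (snd p) \<in> V k \<and> fst (snd p) \<noteq> snd (snd p)))}" for k
  have cont: "(\<lambda>p. fst (fst p)) \<in> borel_measurable (borel :: (('a \<times> 'b) \<times> ('b \<times> 'b)) measure)"
    "(\<lambda>p. snd (fst p)) \<in> borel_measurable (borel :: (('a \<times> 'b) \<times> ('b \<times> 'b)) measure)"
    "(\<lambda>p. fst (snd p)) \<in> borel_measurable (borel :: (('a \<times> 'b) \<times> ('b \<times> 'b)) measure)"
    "(\<lambda>p. snd (snd p)) \<in> borel_measurable (borel :: (('a \<times> 'b) \<times> ('b \<times> 'b)) measure)"
    "fst \<in> borel_measurable (borel :: (('a \<times> 'b) \<times> ('b \<times> 'b)) measure)"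
    by (intro borel_measurable_continuous_onI continuous_intros)+
  note cont[measurable]
  have [measurable]: "V k \<in> sets borel" for k using V(1) by simp
  have pred[measurable]: "P \<in> sets borel" by (rule P)
  have [measurable]: "(\<lambda>p :: ('a \<times> 'b) \<times> ('b \<times> 'b). (fst (fst p), fst (snd p))) \<in> borel_measurable borel"
    "(\<lambda>p :: ('a \<times> 'b) \<times> ('b \<times> 'b). (fst (fst p), snd (snd p))) \<in> borel_measurable borel"
    by (intro borel_measurable_continuous_onI continuous_intros)+
  have [measurable]: "Measurable.pred borel (\<lambda>p :: ('a \<times> 'b) \<times> ('b \<times> 'b). fst (snd p) \<noteq> snd (snd p))"
  proof -
    have "open {p :: ('a \<times> 'b) \<times> ('b \<times> 'b). fst (snd p) \<noteq> snd (snd p)}"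
      by (intro open_Collect_neq continuous_intros)
    then show ?thesis by (simp add: pred_def)
  qed
  have B: "B k \<in> sets borel" for k
    unfolding B_def by measurable
  have cover: "P \<subseteq> (\<Union>k. Q k)"
  proof
    fix z assume "z \<in> P"
    then obtain x y where z: "z = (x, y)" "(x, y) \<in> P" by (cases z) auto
    obtain k where k: "y \<in> V k" "V k \<inter> {y. (x, y) \<in> P} \<subseteq> {y}"
      using base_isolates_finite[OF V(2) fin] by blast
    have "y' = y''" if "(x, y') \<in> P" "(x, y'') \<in> P" "y' \<in> V k" "y'' \<in> V k" for y' y''
    proof -
      have "y' \<in> {y}" "y'' \<in> {y}" using k(2) that by blast+
      then show ?thesis by simp
    qed
    then have "z \<in> Q k" using z k(1) unfolding Q_def by blast
    then show "z \<in> (\<Union>k. Q k)" by blast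
  qed
  have img: "fst ` B k = P - Q k" for k
  proof (rule set_eqI, rule iffI)
    fix z assume "z \<in> fst ` B k"
    then obtain x y y' y'' where "z = (x, y)" "((x, y), (y', y'')) \<in> B k" by auto
    then show "z \<in> P - Q k" unfolding B_def Q_def by auto
  next
    fix z assume "z \<in> P - Q k"
    moreover obtain x y where z: "z = (x, y)" by (cases z)
    ultimately have "\<exists>y' y''. ((x, y), (y', y'')) \<in> B k"
      unfolding B_def Q_def by auto
    then show "z \<in> fst ` B k" using z by force
  qed
  obtain C where C: "\<And>n. C n \<in> sets borel" "\<And>n. C n \<subseteq> Q n" "P = (\<Union>n. C n)"
    by (rule borel_reduction[of P Q B "\<lambda>_. fst"]) (use P cover B img in \<open>auto intro: continuous_on_fst\<close>)
  have "\<exists>g\<in>borel_measurable borel. \<forall>x y. (x, y) \<in> C n \<longrightarrow> g x = y" for n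
  proof -
    have sv: "y = y'" if yy: "(x, y) \<in> C n" "(x, y') \<in> C n" for x y y'
    proof -
      have "(x, y) \<in> P" "(x, y') \<in> P" "(x, y) \<in> Q n" "(x, y') \<in> Q n" using yy C(2,3) by blast+
      then show ?thesis unfolding Q_def by blast
    qed
    show ?thesis by (rule borel_function_of_single_valued[OF C(1)]) (rule sv)
  qed
  then have "\<forall>n. \<exists>g. g \<in> borel_measurable borel \<and> (\<forall>x y. (x, y) \<in> C n \<longrightarrow> g x = y)"
    by blast
  then obtain g where "\<forall>n. g n \<in> borel_measurable borel \<and> (\<forall>x y. (x, y) \<in> C n \<longrightarrow> g n x = y)"
    by (rule choice[THEN exE])
  then have g: "\<And>n. g n \<in> borel_measurable borel" "\<And>n x y. (x, y) \<in> C n \<Longrightarrow> g n x = y"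
    by blast+
  show ?thesis
  proof
    show "g n \<in> borel_measurable borel" for n by (rule g(1))
    show "\<exists>n. g n x = y" if "(x, y) \<in> P" for x y
    proof -
      have "(x, y) \<in> (\<Union>n. C n)"
        by (rule subst[OF C(3), of "\<lambda>S. (x, y) \<in> S"]) (rule that)
      then obtain n where "(x, y) \<in> C n" by blast
      then show ?thesis using g(2) by blast
    qed
  qed
qed

section \<open>Baire category\<close>

lemma nowhere_dense_subset: "nowhere_dense B \<Longrightarrow> A \<subseteq> B \<Longrightarrow> nowhere_dense A"
  unfolding nowhere_dense_def using interior_mono[OF closure_mono[of A B]] by simp

lemma meager_subset:
  fixes A :: "'a::topological_space set"
  assumes "meager B" "A \<subseteq> B"
  shows "meager A"
proof -
  obtain N :: "nat \<Rightarrow> 'a set" where N: "\<And>n. nowhere_dense (N n)" "B = (\<Union>n. N n)"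
    using assms(1) unfolding meager_def by blast
  have "\<forall>n. nowhere_dense (N n \<inter> A)" by (intro allI nowhere_dense_subset[OF N(1) Int_lower1])
  moreover have "A = (\<Union>n. N n \<inter> A)" using assms(2) N(2) by auto
  ultimately show ?thesis unfolding meager_def by (intro exI[of _ "\<lambda>n. N n \<inter> A"]) simp
qed

lemma meager_UN:
  fixes A :: "nat \<Rightarrow> 'a::topological_space set"
  assumes "\<And>n. meager (A n)"
  shows "meager (\<Union>n. A n)"
proof -
  have "\<forall>n. \<exists>N. (\<forall>k::nat. nowhere_dense (N k)) \<and> A n = (\<Union>k. N k)"
    using assms unfolding meager_def by simp
  then obtain N where N: "\<And>n k::nat. nowhere_dense (N n k)" "\<And>n. A n = (\<Union>k. N n k)"
    by metis
  define M where "M m = (case prod_decode m of (n, k) \<Rightarrow> N n k)" for m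
  have "nowhere_dense (M m)" for m unfolding M_def using N(1) by (simp split: prod.split)
  moreover have "(\<Union>n. A n) = (\<Union>m. M m)"
  proof (rule set_eqI, rule iffI)
    fix x assume "x \<in> (\<Union>n. A n)"
    then obtain n k where "x \<in> N n k" using N(2) by auto
    then have "x \<in> M (prod_encode (n, k))" by (simp add: M_def)
    then show "x \<in> (\<Union>m. M m)" by blast
  next
    fix x assume "x \<in> (\<Union>m. M m)"
    then obtain m where "x \<in> M m" by blast
    then have "x \<in> A (fst (prod_decode m))" unfolding M_def N(2) by (auto split: prod.splits)
    then show "x \<in> (\<Union>n. A n)" by blast
  qed
  ultimately show ?thesis unfolding meager_def by blast
qed

lemma meager_empty: "meager {}"
  unfolding meager_def by (intro exI[of _ "\<lambda>_. {}"]) (simp add: nowhere_dense_def)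

lemma meager_Un:
  assumes "meager A" "meager B"
  shows "meager (A \<union> B)"
proof -
  have "meager (\<Union>n::nat. if n = 0 then A else B)" using assms by (intro meager_UN) simp
  then show ?thesis by (rule meager_subset) auto
qed

lemma nowhere_dense_imp_meager: "nowhere_dense A \<Longrightarrow> meager A"
  unfolding meager_def by (intro exI[of _ "\<lambda>_. A"]) simp

lemma nonmeager_open:
  fixes U :: "'a::complete_space set"
  assumes "open U" "U \<noteq> {}"
  shows "\<not> meager U"
proof
  assume "meager U"
  then obtain N :: "nat \<Rightarrow> 'a set" where N: "\<And>n. nowhere_dense (N n)" "U = (\<Union>n. N n)"
    unfolding meager_def by blast
  define \<G> where "\<G> = range (\<lambda>n. - closure (N n))"
  have "Met_TC.mtopology closure_of \<Inter>\<G> = (UNIV :: 'a set)"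
  proof (rule Met_TC.metric_Baire_category)
    show "Met_TC.mcomplete TYPE('a)" using complete_UNIV by simp
    show "countable \<G>" unfolding \<G>_def by simp
    show "openin Met_TC.mtopology T \<and> Met_TC.mtopology closure_of T = UNIV" if "T \<in> \<G>" for T
    proof -
      obtain n where T: "T = - closure (N n)" using \<open>T \<in> \<G>\<close> unfolding \<G>_def by blast
      have "closure T = UNIV"
        using N(1)[of n] unfolding T nowhere_dense_def by (simp add: closure_complement)
      moreover have "open T" unfolding T by auto
      ultimately show ?thesis by simp
    qed
  qed
  then have "closure (\<Inter>\<G>) = UNIV" by simp
  moreover have "U \<inter> \<Inter>\<G> = {}"
    unfolding \<G>_def N(2) using closure_subset by blast
  ultimately show False
    using assms open_Int_closure_eq_empty[of U "\<Inter>\<G>"] by simp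
qed

lemma borel_baire_property:
  fixes B :: "'a::topological_space set"
  assumes "B \<in> sets borel"
  shows "\<exists>U. open U \<and> meager (B - U) \<and> meager (U - B)"
proof -
  have "B \<in> sigma_sets UNIV {S. open S}"
    using assms by (simp add: sets_borel)
  then show ?thesis
  proof induction
    case (Basic a)
    then show ?case by (intro exI[of _ a]) (simp add: meager_empty)
  next
    case Empty
    then show ?case by (intro exI[of _ "{}"]) (simp add: meager_empty)
  next
    case (Compl a)
    then obtain U where U: "open U" "meager (a - U)" "meager (U - a)" by blast
    \<comment> \<open>The open set for the complement is \<open>- closure U\<close>; it differs from
      \<open>- U\<close> only by the boundary of \<open>U\<close>.\<close>
    have "nowhere_dense (closure U - U)"
    proof -
      have "closed (closure U - U)" using U(1) by (simp add: closed_Diff)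
      moreover have "interior (closure U - U) = {}"
      proof (rule ccontr)
        assume "interior (closure U - U) \<noteq> {}"
        moreover have "interior (closure U - U) \<inter> U = {}" using interior_subset by blast
        then have "interior (closure U - U) \<inter> closure U = {}"
          by (simp add: open_Int_closure_eq_empty)
        ultimately show False using interior_subset by blast
      qed
      ultimately show ?thesis unfolding nowhere_dense_def by simp
    qed
    then have "meager ((closure U - U) \<union> (U - a))"
      by (intro meager_Un nowhere_dense_imp_meager U)
    then have "meager ((UNIV - a) - (- closure U))"
      by (rule meager_subset) blast
    moreover have "meager ((- closure U) - (UNIV - a))"
      using U(2) by (rule meager_subset) (use closure_subset in blast)
    moreover have "open (- closure U)" by auto
    ultimately show ?case by blast
  next
    case (Union a)
    then have "\<forall>n. \<exists>U. open U \<and> meager (a n - U) \<and> meager (U - a n)" by blast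
    then obtain U where U: "\<And>n. open (U n)" "\<And>n. meager (a n - U n)" "\<And>n. meager (U n - a n)"
      by metis
    have "meager ((\<Union>n. a n) - (\<Union>n. U n))"
      by (rule meager_subset[OF meager_UN[of "\<lambda>n. a n - U n"]]) (use U(2) in auto)
    moreover have "meager ((\<Union>n. U n) - (\<Union>n. a n))"
      by (rule meager_subset[OF meager_UN[of "\<lambda>n. U n - a n"]]) (use U(3) in auto)
    ultimately show ?case using U(1) by blast
  qed
qed

text \<open>
  This replaces a Kuratowski--Ulam argument: stage \<open>n\<close> of the choice of \<open>s\<close> makes the \<open>i\<close>-th union
  nonmeager in the \<open>j\<close>-th basic open set, where \<open>n\<close> codes \<open>(i, j)\<close>.
\<close>

theorem generic_selection:
  fixes D :: "nat \<Rightarrow> nat \<Rightarrow> nat \<Rightarrow> 'a::polish_space set"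
  assumes D: "\<And>i n k. D i n k \<in> sets borel" and cover: "\<And>i n. (\<Union>k. D i n k) = UNIV"
  shows "\<exists>s. \<forall>i. comeager (\<Union>n. D i n (s n))"
proof -
  obtain V :: "nat \<Rightarrow> 'a set" where V: "\<And>k. open (V k)"
      "\<And>x U. open U \<Longrightarrow> x \<in> U \<Longrightarrow> \<exists>k. x \<in> V k \<and> V k \<subseteq> U"
    using countable_base_sequence by blast
  have "\<exists>k. V j = {} \<or> \<not> meager (D i n k \<inter> V j)" for i j n
  proof (rule ccontr)
    assume neg: "\<nexists>k. V j = {} \<or> \<not> meager (D i n k \<inter> V j)"
    then have "meager (\<Union>k. D i n k \<inter> V j)" by (intro meager_UN) blast
    moreover have "V j \<subseteq> (\<Union>k. D i n k \<inter> V j)" using cover[of i n] by blast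
    ultimately have "meager (V j)" by (rule meager_subset)
    then show False using nonmeager_open V(1) neg by blast
  qed
  then have "\<forall>i j n. \<exists>k. V j = {} \<or> \<not> meager (D i n k \<inter> V j)" by simp
  then obtain c where c: "\<And>i j n. V j = {} \<or> \<not> meager (D i n (c i j n) \<inter> V j)"
    unfolding choice_iff by blast
  define s where "s n = (case prod_decode n of (i, j) \<Rightarrow> c i j n)" for n
  have "comeager (\<Union>n. D i n (s n))" for i
  proof -
    define C where "C = - (\<Union>n. D i n (s n))"
    have "C \<in> sets borel" unfolding C_def using D by (simp add: sets.countable_UN' borel_comp)
    then obtain U where U: "open U" "meager (C - U)" "meager (U - C)"
      using borel_baire_property by blast
    \<comment> \<open>A nonempty \<open>U\<close> contains some nonempty \<open>V j\<close>. The
      stage coding \<open>(i, j)\<close> put a nonmeager subset of \<open>V j\<close> outside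
      \<open>C\<close>, yet \<open>U - C\<close> is meager.\<close>
    have "U = {}"
    proof (rule ccontr)
      assume "U \<noteq> {}"
      then obtain x j where j: "x \<in> V j" "V j \<subseteq> U" using V(2)[OF U(1)] by blast
      define n where "n = prod_encode (i, j)"
      have "s n = c i j n" by (simp add: s_def n_def)
      then have "\<not> meager (D i n (s n) \<inter> V j)" using c[where i=i and j=j and n=n] j by auto
      moreover have "D i n (s n) \<inter> V j \<subseteq> U - C" using j(2) unfolding C_def by blast
      ultimately show False using U(3) meager_subset by blast
    qed
    then show ?thesis using U(2) unfolding comeager_def C_def by simp
  qed
  then show ?thesis by blast
qed

lemma comeager_INT:
  fixes A :: "nat \<Rightarrow> 'a::topological_space set"
  assumes "\<And>n. comeager (A n)"
  shows "comeager (\<Inter>n. A n)"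
  using assms meager_UN[of "\<lambda>n. - A n"] unfolding comeager_def by simp

section \<open>Chains and proper extended metrics\<close>

text \<open>The closure is reflexive on the whole type, so a point outside \<open>S\<close> is its
  own component and statements about components can quantify over all points.\<close>

definition chain :: "('a \<Rightarrow> 'a \<Rightarrow> ennreal) \<Rightarrow> 'a set \<Rightarrow> real \<Rightarrow> ('a \<times> 'a) set" where
  "chain \<rho> S r = {(x, y). x \<in> S \<and> y \<in> S \<and> \<rho> x y \<le> ennreal r}\<^sup>*"

lemma chain_refl [simp]: "(x, x) \<in> chain \<rho> S r"
  unfolding chain_def by simp

lemma chain_trans: "(x, y) \<in> chain \<rho> S r \<Longrightarrow> (y, z) \<in> chain \<rho> S r \<Longrightarrow> (x, z) \<in> chain \<rho> S r"
  unfolding chain_def by (rule rtrancl_trans)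

lemma chain_single: "x \<in> S \<Longrightarrow> y \<in> S \<Longrightarrow> \<rho> x y \<le> ennreal r \<Longrightarrow> (x, y) \<in> chain \<rho> S r"
  unfolding chain_def by (rule r_into_rtrancl) simp

lemma chain_step:
  "(x, y) \<in> chain \<rho> S r \<Longrightarrow> y \<in> S \<Longrightarrow> z \<in> S \<Longrightarrow> \<rho> y z \<le> ennreal r \<Longrightarrow> (x, z) \<in> chain \<rho> S r"
  by (blast intro: chain_trans chain_single)

lemma chain_induct [consumes 1, case_names refl step]:
  assumes "(x, y) \<in> chain \<rho> S r" "P x"
    and "\<And>y z. (x, y) \<in> chain \<rho> S r \<Longrightarrow> y \<in> S \<Longrightarrow> z \<in> S \<Longrightarrow> \<rho> y z \<le> ennreal r \<Longrightarrow> P y \<Longrightarrow> P z"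
  shows "P y"
  using assms(1) unfolding chain_def
proof (induction rule: rtrancl_induct)
  case base
  show ?case by (rule assms(2))
next
  case (step y z)
  then show ?case using assms(3)[of y z] unfolding chain_def by blast
qed

lemma chain_mono:
  assumes "S \<subseteq> T" "r \<le> s"
  shows "chain \<rho> S r \<subseteq> chain \<rho> T s"
  unfolding chain_def
  by (rule rtrancl_mono) (use assms in \<open>auto intro: order_trans ennreal_leI\<close>)

lemma chain_in: "(x, y) \<in> chain \<rho> S r \<Longrightarrow> x \<in> S \<Longrightarrow> y \<in> S"
  by (induction rule: chain_induct) auto

lemma chain_in_or_eq: "(x, y) \<in> chain \<rho> S r \<Longrightarrow> x = y \<or> (x \<in> S \<and> y \<in> S)"
  unfolding chain_def by (erule rtranclE, simp) (metis (no_types, lifting) case_prodD converse_rtranclE mem_Collect_eq)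

lemma chain_invariant:
  assumes "(x, y) \<in> chain \<rho> S r" "x \<in> T"
    and "\<And>y z. y \<in> S \<inter> T \<Longrightarrow> z \<in> S \<Longrightarrow> \<rho> y z \<le> ennreal r \<Longrightarrow> z \<in> T"
  shows "(x, y) \<in> chain \<rho> (S \<inter> T) r \<and> y \<in> T"
  using assms(1)
proof (induction rule: chain_induct)
  case refl
  then show ?case using assms(2) by simp
next
  case (step y z)
  then have "z \<in> T" using assms(3)[of y z] by blast
  then show ?case using step by (blast intro: chain_step)
qed

text \<open>Reduces a bound for all chains to chains that start in \<open>B\<close>: if
  \<open>B\<close> is visited, both ends are measured from the visited point.\<close>

lemma chain_Un_cases:
  assumes "(x, y) \<in> chain \<rho> (A \<union> B) r"
  shows "(x, y) \<in> chain \<rho> A r \<or>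
    (\<exists>u\<in>B. (x, u) \<in> chain \<rho> (A \<union> B) r \<and> (u, y) \<in> chain \<rho> (A \<union> B) r)"
  using assms
proof (induction rule: chain_induct)
  case refl
  then show ?case by simp
next
  case (step y z)
  show ?case
  proof (cases "\<exists>u\<in>B. (x, u) \<in> chain \<rho> (A \<union> B) r \<and> (u, y) \<in> chain \<rho> (A \<union> B) r")
    case True
    then show ?thesis using step by (blast intro: chain_step)
  next
    case False
    then have 1: "(x, y) \<in> chain \<rho> A r" using step by blast
    have "y \<notin> B" using False step by (metis chain_refl)
    then have "y \<in> A" using step by blast
    show ?thesis
    proof (cases "z \<in> B")
      case True
      then show ?thesis using step by (metis chain_refl chain_step)
    next
      case False
      then have "z \<in> A" using step by blast
      then show ?thesis using 1 \<open>y \<in> A\<close> step by (blast intro: chain_step)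
    qed
  qed
qed

section \<open>Proper extended metrics with a Borel enumeration of their classes\<close>

locale enumerated_metric =
  fixes \<rho> :: "'a::polish_space \<Rightarrow> 'a \<Rightarrow> ennreal" and f :: "nat \<Rightarrow> 'a \<Rightarrow> 'a"
  assumes ext_metric: "ext_metric_on UNIV \<rho>" and proper: "proper_on UNIV \<rho>"
    and rho_borel: "(\<lambda>p. \<rho> (fst p) (snd p)) \<in> borel_measurable borel"
    and f_borel [measurable]: "\<And>n. f n \<in> borel_measurable borel"
    and enum: "\<And>x y. \<rho> x y < \<infinity> \<longleftrightarrow> (\<exists>n. y = f n x)"
begin

lemma rho_refl [simp]: "\<rho> x x = 0"
  using ext_metric unfolding ext_metric_on_def by simp

lemma rho_sym: "\<rho> x y = \<rho> y x"
  using ext_metric unfolding ext_metric_on_def by simp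

lemma rho_triangle: "\<rho> x z \<le> \<rho> x y + \<rho> y z"
  using ext_metric unfolding ext_metric_on_def by simp

lemma rho_le_add:
  assumes "\<rho> x y \<le> ennreal a" "\<rho> y z \<le> ennreal b" "0 \<le> a" "0 \<le> b"
  shows "\<rho> x z \<le> ennreal (a + b)"
  using rho_triangle[of x z y] add_mono[OF assms(1,2)] assms(3,4)
  by simp

lemma rho_le_mono: "\<rho> x y \<le> ennreal a \<Longrightarrow> a \<le> b \<Longrightarrow> \<rho> x y \<le> ennreal b"
  by (meson ennreal_leI order_trans)

lemma rho_le_trans:
  assumes "\<rho> x y \<le> ennreal a" "\<rho> y z \<le> ennreal b" "0 \<le> a" "0 \<le> b" "a + b \<le> c"
  shows "\<rho> x z \<le> ennreal c"
  using rho_le_add[OF assms(1-4)] assms(5) by (rule rho_le_mono)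

lemma rho_le_finite: "\<rho> x y \<le> ennreal a \<Longrightarrow> \<rho> x y < \<infinity>"
  by (simp add: le_less_trans)

lemma rho_finite_trans: "\<rho> x y < \<infinity> \<Longrightarrow> \<rho> y z < \<infinity> \<Longrightarrow> \<rho> x z < \<infinity>"
  using rho_triangle[of x z y] by (metis ennreal_add_less_top infinity_ennreal_def le_less_trans)

lemma finite_bounded: "finite {y. \<rho> x y \<le> ennreal a}"
  using proper unfolding proper_on_def rho_ball_def by simp

lemma ex_class: "(\<exists>y. \<rho> x y < \<infinity> \<and> \<phi> y) \<longleftrightarrow> (\<exists>n. \<phi> (f n x))"
  using enum by auto

lemma chain_sym: "(x, y) \<in> chain \<rho> S r \<Longrightarrow> (y, x) \<in> chain \<rho> S r"
proof (induction rule: chain_induct)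
  case refl
  show ?case by simp
next
  case (step y z)
  then have "(z, y) \<in> chain \<rho> S r" using rho_sym by (metis chain_single)
  then show ?case using step chain_trans by metis
qed

lemma chain_finite: "(x, y) \<in> chain \<rho> S r \<Longrightarrow> \<rho> x y < \<infinity>"
proof (induction rule: chain_induct)
  case refl
  show ?case by simp
next
  case (step y z)
  then show ?case using rho_finite_trans rho_le_finite by blast
qed

lemma borel_pair_pred [measurable (raw)]:
  assumes "G \<in> sets (borel :: ('a \<times> 'a) measure)" "g \<in> borel_measurable M" "h \<in> borel_measurable M"
  shows "Measurable.pred M (\<lambda>x. (g x, h x) \<in> G)"
proof -
  have [measurable]: "(\<lambda>x. (g x, h x)) \<in> borel_measurable M" "G \<in> sets borel"
    using assms by (auto intro: borel_measurable_Pair)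
  show ?thesis by measurable
qed

lemma borel_rho [measurable (raw)]:
  assumes "g \<in> borel_measurable M" "h \<in> borel_measurable M"
  shows "(\<lambda>x. \<rho> (g x) (h x)) \<in> borel_measurable M"
  using measurable_compose[OF borel_measurable_Pair[OF assms] rho_borel] by simp

lemma borel_eq_pred [measurable (raw)]:
  assumes "g \<in> borel_measurable M" "h \<in> borel_measurable M"
  shows "Measurable.pred M (\<lambda>x. g x = (h x :: 'a))"
proof -
  have "closed {p :: 'a \<times> 'a. fst p = snd p}" by (intro closed_Collect_eq continuous_intros)
  then have "{p :: 'a \<times> 'a. fst p = snd p} \<in> sets borel" by simp
  from borel_pair_pred[OF this assms] show ?thesis by simp
qed

lemma fst_borel [measurable]: "fst \<in> borel_measurable (borel :: ('a \<times> 'a) measure)"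
  and snd_borel [measurable]: "snd \<in> borel_measurable (borel :: ('a \<times> 'a) measure)"
  by (intro borel_measurable_continuous_onI continuous_intros)+

text \<open>A composition of Borel relations is in general only analytic. Here the intermediate
  point has finite distance from the first one, so it ranges over the countably many values
  \<open>f i\<close>.\<close>

lemma borel_chain [measurable (raw)]:
  assumes [measurable]: "S \<in> sets borel"
  shows "chain \<rho> S r \<in> sets borel"
proof -
  define R where "R = {(x, y). x \<in> S \<and> y \<in> S \<and> \<rho> x y \<le> ennreal r}"
  have "R = {p. fst p \<in> S \<and> snd p \<in> S \<and> \<rho> (fst p) (snd p) \<le> ennreal r}"
    unfolding R_def by auto
  moreover have "{p. fst p \<in> S \<and> snd p \<in> S \<and> \<rho> (fst p) (snd p) \<le> ennreal r} \<in> sets borel"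
    by measurable
  ultimately have R[measurable]: "R \<in> sets borel" by simp
  have "(R ^^ n) \<in> sets borel" for n
  proof (induction n)
    case 0
    have "{p :: 'a \<times> 'a. fst p = snd p} \<in> sets borel" by measurable
    moreover have "{p :: 'a \<times> 'a. fst p = snd p} = Id" by auto
    ultimately show ?case by simp
  next
    case (Suc n)
    note Suc[measurable]
    have sub: "\<rho> x y < \<infinity>" if "(x, y) \<in> R ^^ n" for x y
      using that chain_finite[of x y S r] relpow_imp_rtrancl unfolding chain_def R_def by blast
    have "R ^^ Suc n = {p. \<exists>i. (fst p, f i (fst p)) \<in> R ^^ n \<and> (f i (fst p), snd p) \<in> R}"
    proof (rule set_eqI)
      fix p :: "'a \<times> 'a"
      have "p \<in> R ^^ Suc n \<longleftrightarrow> (\<exists>y. (fst p, y) \<in> R ^^ n \<and> (y, snd p) \<in> R)"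
        by (cases p) auto
      also have "\<dots> \<longleftrightarrow> (\<exists>y. \<rho> (fst p) y < \<infinity> \<and> (fst p, y) \<in> R ^^ n \<and> (y, snd p) \<in> R)"
        using sub by blast
      also have "\<dots> \<longleftrightarrow> (\<exists>i. (fst p, f i (fst p)) \<in> R ^^ n \<and> (f i (fst p), snd p) \<in> R)"
        by (rule ex_class)
      finally show "p \<in> R ^^ Suc n \<longleftrightarrow>
          p \<in> {p. \<exists>i. (fst p, f i (fst p)) \<in> R ^^ n \<and> (f i (fst p), snd p) \<in> R}" by simp
    qed
    also have "\<dots> \<in> sets borel" by measurable
    finally show ?case .
  qed
  then have "(\<Union>n. R ^^ n) \<in> sets borel" by blast
  then show ?thesis unfolding chain_def R_def[symmetric] rtrancl_is_UN_relpow .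
qed

text \<open>\<open>C k\<close> consists of the points that \<open>V k\<close> isolates in their
  \<open>g\<close>-ball. Two points of \<open>C k\<close> at distance at most \<open>g\<close> both
  lie in \<open>V k\<close>, hence coincide.\<close>

lemma sparse_cover:
  "\<exists>C :: nat \<Rightarrow> 'a set. (\<forall>k. C k \<in> sets borel) \<and> (\<Union>k. C k) = UNIV \<and>
     (\<forall>k. \<forall>x\<in>C k. \<forall>y\<in>C k. \<rho> x y \<le> ennreal g \<longrightarrow> x = y)"
proof -
  obtain V :: "nat \<Rightarrow> 'a set" where V: "\<And>k. open (V k)"
      "\<And>x U. open U \<Longrightarrow> x \<in> U \<Longrightarrow> \<exists>k. x \<in> V k \<and> V k \<subseteq> U"
    using countable_base_sequence by blast
  have [measurable]: "V k \<in> sets borel" for k using V(1) by simp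
  define C where "C k = {x. x \<in> V k \<and> (\<forall>i. f i x \<in> V k \<and> \<rho> x (f i x) \<le> ennreal g \<longrightarrow> f i x = x)}" for k
  have "C k \<in> sets borel" for k unfolding C_def by measurable
  moreover have "(\<Union>k. C k) = UNIV"
  proof -
    have "x \<in> (\<Union>k. C k)" for x
    proof -
      obtain k where "x \<in> V k" "V k \<inter> {y. \<rho> x y \<le> ennreal g} \<subseteq> {x}"
        using base_isolates_finite[OF V(2) finite_bounded] by blast
      then have "x \<in> C k" unfolding C_def by blast
      then show ?thesis by blast
    qed
    then show ?thesis by blast
  qed
  moreover have "x = y" if xy: "x \<in> C k" "y \<in> C k" "\<rho> x y \<le> ennreal g" for x y k
  proof -
    obtain i where "y = f i x" using rho_le_finite[OF xy(3)] enum by blast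
    then show ?thesis using xy unfolding C_def by auto
  qed
  ultimately show ?thesis by (intro exI[of _ C] conjI) simp_all
qed

text \<open>\<open>generic_selection\<close> is applied to the preimages of the sparse covers under
  each \<open>f i\<close>. One choice of \<open>s\<close> works for all \<open>i\<close>, so for
  comeagerly many points the whole class is covered.\<close>

lemma generic_sparse_sequence:
  fixes g :: "nat \<Rightarrow> real"
  obtains A where "\<And>n::nat. A n \<in> sets borel"
    "\<And>n x y. x \<in> A n \<Longrightarrow> y \<in> A n \<Longrightarrow> \<rho> x y \<le> ennreal (g n) \<Longrightarrow> x = y"
    "comeager {x. \<forall>i. \<exists>n. f i x \<in> A n}"
proof -
  have "\<forall>n. \<exists>C :: nat \<Rightarrow> 'a set. (\<forall>k. C k \<in> sets borel) \<and> (\<Union>k. C k) = UNIV \<and>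
     (\<forall>k. \<forall>x\<in>C k. \<forall>y\<in>C k. \<rho> x y \<le> ennreal (g n) \<longrightarrow> x = y)"
    by (intro allI sparse_cover)
  then obtain C :: "nat \<Rightarrow> nat \<Rightarrow> 'a set" where C: "\<forall>n. (\<forall>k. C n k \<in> sets borel) \<and> (\<Union>k. C n k) = UNIV \<and>
     (\<forall>k. \<forall>x\<in>C n k. \<forall>y\<in>C n k. \<rho> x y \<le> ennreal (g n) \<longrightarrow> x = y)"
    by (rule choice[THEN exE])
  have C_borel[measurable]: "C n k \<in> sets borel" and C_cover: "(\<Union>k. C n k) = UNIV"
    and C_sparse: "x \<in> C n k \<Longrightarrow> y \<in> C n k \<Longrightarrow> \<rho> x y \<le> ennreal (g n) \<Longrightarrow> x = y" for n k x y
    using C by simp_all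
  have "\<exists>s. \<forall>i. comeager (\<Union>n. {x. f i x \<in> C n (s n)})"
  proof (rule generic_selection[of "\<lambda>i n k. {x. f i x \<in> C n k}"])
    show "{x. f i x \<in> C n k} \<in> sets borel" for i n k by measurable
    show "(\<Union>k. {x. f i x \<in> C n k}) = UNIV" for i n using C_cover[of n] by auto
  qed
  then obtain s where s: "\<And>i. comeager (\<Union>n. {x. f i x \<in> C n (s n)})" by blast
  have "comeager (\<Inter>i. \<Union>n. {x. f i x \<in> C n (s n)})" using s by (rule comeager_INT)
  moreover have "(\<Inter>i. \<Union>n. {x. f i x \<in> C n (s n)}) = {x. \<forall>i. \<exists>n. f i x \<in> C n (s n)}" by auto
  ultimately show ?thesis
    using that[of "\<lambda>n. C n (s n)"] C_borel C_sparse by simp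
qed

end

text \<open>By properness the relation of having distance at most \<open>m\<close> has finite
  sections, so it can be uniformized; all \<open>m\<close> together exhaust the classes.\<close>

theorem enumerated_metric_exists:
  fixes \<rho> :: "'a::polish_space \<Rightarrow> 'a \<Rightarrow> ennreal"
  assumes "ext_metric_on UNIV \<rho>" and "proper_on UNIV \<rho>"
    and "(\<lambda>(x, y). \<rho> x y) \<in> borel_measurable (borel :: ('a \<times> 'a) measure)"
  shows "\<exists>f. enumerated_metric \<rho> f"
proof -
  have rho[measurable]: "(\<lambda>p. \<rho> (fst p) (snd p)) \<in> borel_measurable borel"
    using assms(3) by (simp add: case_prod_beta')
  have refl: "\<rho> x x = 0" for x using assms(1) unfolding ext_metric_on_def by simp
  have "\<exists>g :: nat \<Rightarrow> 'a \<Rightarrow> 'a. (\<forall>n. g n \<in> borel_measurable borel) \<and>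
      (\<forall>x y. \<rho> x y \<le> ennreal (real m) \<longrightarrow> (\<exists>n. g n x = y))" for m :: nat
  proof -
    define P where "P = {p. \<rho> (fst p) (snd p) \<le> ennreal (real m)}"
    have P: "P \<in> sets borel" unfolding P_def by measurable
    have fin: "finite {y. (x, y) \<in> P}" for x
      using assms(2) unfolding proper_on_def rho_ball_def P_def by simp
    obtain g :: "nat \<Rightarrow> 'a \<Rightarrow> 'a" where "\<And>n. g n \<in> borel_measurable borel"
        "\<And>x y. (x, y) \<in> P \<Longrightarrow> \<exists>n. g n x = y"
      using borel_finite_sections_uniformization[OF P fin] by blast
    then show ?thesis unfolding P_def by auto
  qed
  then have "\<forall>m::nat. \<exists>g :: nat \<Rightarrow> 'a \<Rightarrow> 'a. (\<forall>n. g n \<in> borel_measurable borel) \<and>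
      (\<forall>x y. \<rho> x y \<le> ennreal (real m) \<longrightarrow> (\<exists>n. g n x = y))" by blast
  then obtain g :: "nat \<Rightarrow> nat \<Rightarrow> 'a \<Rightarrow> 'a" where g: "\<forall>m. (\<forall>n. g m n \<in> borel_measurable borel) \<and>
      (\<forall>x y. \<rho> x y \<le> ennreal (real m) \<longrightarrow> (\<exists>n. g m n x = y))"
    by (rule choice[THEN exE])
  have [measurable]: "g m n \<in> borel_measurable borel" for m n using g by blast
  \<comment> \<open>The uniformizing functions are arbitrary off their Borel piece; values outside
    the class of \<open>x\<close> are reset to \<open>x\<close>, which is in it.\<close>
  define h where "h m n x = (if \<rho> x (g m n x) < \<infinity> then g m n x else x)" for m n x
  have h[measurable]: "h m n \<in> borel_measurable borel" for m n
  proof -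
    have "(\<lambda>x. \<rho> x (g m n x)) \<in> borel_measurable borel"
      using measurable_compose[OF borel_measurable_Pair[of "\<lambda>x. x" borel "g m n"] rho] by simp
    note [measurable] = this
    show ?thesis unfolding h_def by measurable
  qed
  define f where "f i = h (fst (prod_decode i)) (snd (prod_decode i))" for i
  have "enumerated_metric \<rho> f"
  proof
    show "f i \<in> borel_measurable borel" for i unfolding f_def by (rule h)
    fix x y
    show "\<rho> x y < \<infinity> \<longleftrightarrow> (\<exists>i. y = f i x)"
    proof
      assume fin: "\<rho> x y < \<infinity>"
      then obtain m :: nat where "\<rho> x y \<le> ennreal (real m)"
        by (metis ennreal_Ex_less_of_nat ennreal_of_nat_eq_real_of_nat infinity_ennreal_def less_imp_le)
      then obtain n where "g m n x = y" using g by blast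
      then have "y = f (prod_encode (m, n)) x" using fin by (simp add: f_def h_def)
      then show "\<exists>i. y = f i x" ..
    next
      assume "\<exists>i. y = f i x"
      then show "\<rho> x y < \<infinity>" by (auto simp: f_def h_def refl)
    qed
  qed (use assms rho in auto)
  then show ?thesis by blast
qed

section \<open>Generic covers with finite components\<close>

context enumerated_metric
begin

text \<open>The point \<open>a\<close> together with the \<open>2t\<close>-neighbourhoods of all
  \<open>4t\<close>-components of \<open>S\<close> that come within \<open>2t\<close> of
  \<open>a\<close>. Chains use \<open>4t\<close> because two points of \<open>S\<close> within
  \<open>2t\<close> of a common point are then in one component.\<close>

definition cap :: "real \<Rightarrow> 'a set \<Rightarrow> 'a \<Rightarrow> 'a set" where
  "cap t S a = insert a {y. \<exists>p\<in>S. \<exists>q\<in>S. \<rho> a p \<le> ennreal (2 * t) \<and>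
     (p, q) \<in> chain \<rho> S (4 * t) \<and> \<rho> q y \<le> ennreal (2 * t)}"

lemma cap_self [simp]: "a \<in> cap t S a"
  unfolding cap_def by simp

lemma cap_bounded:
  assumes t: "0 \<le> t" and L: "0 \<le> L"
    and bd: "\<And>x y. (x, y) \<in> chain \<rho> S (4 * t) \<Longrightarrow> \<rho> x y \<le> ennreal L"
    and y: "y \<in> cap t S a"
  shows "\<rho> a y \<le> ennreal (L + 4 * t)"
proof (cases "y = a")
  case False
  then obtain p q where pq: "\<rho> a p \<le> ennreal (2 * t)" "(p, q) \<in> chain \<rho> S (4 * t)"
      "\<rho> q y \<le> ennreal (2 * t)"
    using y unfolding cap_def by blast
  have "\<rho> a q \<le> ennreal (2 * t + L)" by (rule rho_le_trans[OF pq(1) bd[OF pq(2)]]) (use t L in auto)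
  then have "\<rho> a y \<le> ennreal (2 * t + L + 2 * t)" by (rule rho_le_trans[OF _ pq(3)]) (use t L in auto)
  then show ?thesis by (rule rho_le_mono) simp
qed simp

text \<open>A component of \<open>S\<close> within \<open>2t\<close> of a point \<open>y\<close>
  other than \<open>a\<close> in the cap is joined by one \<open>4t\<close>-step, through
  \<open>y\<close>, to a component already used. So the cap swallows it with its
  neighbourhood.\<close>

lemma cap_absorbs:
  assumes t: "0 \<le> t" and p: "p \<in> S" and y: "y \<in> cap t S a" and yp: "\<rho> y p \<le> ennreal (2 * t)"
    and pq: "(p, q) \<in> chain \<rho> S (4 * t)" and qz: "\<rho> q z \<le> ennreal (2 * t)"
  shows "z \<in> cap t S a"
proof -
  have q: "q \<in> S" using chain_in[OF pq p] .
  show ?thesis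
  proof (cases "y = a")
    case True
    then show ?thesis using p q yp pq qz unfolding cap_def by blast
  next
    case False
    then obtain p0 q0 where pq0: "p0 \<in> S" "q0 \<in> S" "\<rho> a p0 \<le> ennreal (2 * t)"
        "(p0, q0) \<in> chain \<rho> S (4 * t)" "\<rho> q0 y \<le> ennreal (2 * t)"
      using y unfolding cap_def by blast
    have "\<rho> q0 p \<le> ennreal (4 * t)"
      by (rule rho_le_trans[OF pq0(5) yp]) (use t in auto)
    then have "(p0, q) \<in> chain \<rho> S (4 * t)"
      using pq0(4) pq0(2) p pq by (meson chain_step chain_trans)
    then show ?thesis using pq0 q qz unfolding cap_def by blast
  qed
qed

lemma cap_separated:
  assumes t: "0 \<le> t" and L: "0 \<le> L"
    and bd: "\<And>x y. (x, y) \<in> chain \<rho> S (4 * t) \<Longrightarrow> \<rho> x y \<le> ennreal L"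
    and sparse: "\<And>a b. a \<in> A \<Longrightarrow> b \<in> A \<Longrightarrow> \<rho> a b \<le> ennreal (3 * L + 16 * t) \<Longrightarrow> a = b"
    and ab: "a \<in> A" "b \<in> A" and y: "y \<in> cap t S a" and z: "z \<in> cap t S b"
    and yz: "\<rho> y z \<le> ennreal (4 * t)"
  shows "a = b"
proof (rule sparse[OF ab])
  have 1: "\<rho> a y \<le> ennreal (L + 4 * t)" by (rule cap_bounded[OF t L bd y])
  have 2: "\<rho> z b \<le> ennreal (L + 4 * t)" using cap_bounded[OF t L bd z] rho_sym by simp
  have "\<rho> a z \<le> ennreal (L + 4 * t + 4 * t)" by (rule rho_le_trans[OF 1 yz]) (use t L in auto)
  then have "\<rho> a b \<le> ennreal (L + 4 * t + 4 * t + (L + 4 * t))" by (rule rho_le_trans[OF _ 2]) (use t L in auto)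
  then show "\<rho> a b \<le> ennreal (3 * L + 16 * t)" by (rule rho_le_mono) (use t L in simp)
qed

text \<open>A \<open>4t\<close>-chain that starts in one cap never reaches another: it stays in this
  cap or in a component of \<open>S\<close> one step away from it. So it remains within
  \<open>(L + 4t) + 4t + L\<close> of the centre, and twice this is the new bound.\<close>

lemma cap_chain_bounded:
  assumes t: "0 \<le> t" and L: "0 \<le> L"
    and bd: "\<And>x y. (x, y) \<in> chain \<rho> S (4 * t) \<Longrightarrow> \<rho> x y \<le> ennreal L"
    and sparse: "\<And>a b. a \<in> A \<Longrightarrow> b \<in> A \<Longrightarrow> \<rho> a b \<le> ennreal (3 * L + 16 * t) \<Longrightarrow> a = b"
    and xy: "(x, y) \<in> chain \<rho> (S \<union> (\<Union>a\<in>A. cap t S a)) (4 * t)"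
  shows "\<rho> x y \<le> ennreal (4 * L + 16 * t)"
proof -
  let ?S' = "S \<union> (\<Union>a\<in>A. cap t S a)"
  have near: "y \<in> cap t S a \<or> (\<exists>p\<in>S. \<exists>v\<in>cap t S a. \<rho> v p \<le> ennreal (4 * t) \<and> (p, y) \<in> chain \<rho> S (4 * t))"
    if "(u, y) \<in> chain \<rho> ?S' (4 * t)" "u \<in> cap t S a" "a \<in> A" for u y a
    using that(1)
  proof (induction rule: chain_induct)
    case refl
    then show ?case using \<open>u \<in> cap t S a\<close> by simp
  next
    case (step y z)
    consider "z \<in> S" | b where "b \<in> A" "z \<in> cap t S b" using step by blast
    then show ?case
    proof cases
      case 1
      from step.IH show ?thesis
      proof
        assume "y \<in> cap t S a"
        then show ?thesis using 1 step by (metis chain_refl)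
      next
        assume "\<exists>p\<in>S. \<exists>v\<in>cap t S a. \<rho> v p \<le> ennreal (4 * t) \<and> (p, y) \<in> chain \<rho> S (4 * t)"
        then show ?thesis using 1 step by (meson chain_in chain_step)
      qed
    next
      case 2
      from step.IH have "a = b"
      proof
        assume "y \<in> cap t S a"
        then show ?thesis using cap_separated[OF t L bd sparse \<open>a \<in> A\<close> 2(1) _ 2(2)] step by blast
      next
        assume "\<exists>p\<in>S. \<exists>v\<in>cap t S a. \<rho> v p \<le> ennreal (4 * t) \<and> (p, y) \<in> chain \<rho> S (4 * t)"
        then obtain p v where pv: "v \<in> cap t S a" "\<rho> v p \<le> ennreal (4 * t)" "(p, y) \<in> chain \<rho> S (4 * t)"
          by blast
        have 1: "\<rho> a v \<le> ennreal (L + 4 * t)" by (rule cap_bounded[OF t L bd pv(1)])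
        have 2: "\<rho> z b \<le> ennreal (L + 4 * t)" using cap_bounded[OF t L bd 2(2)] rho_sym by simp
        have "\<rho> a p \<le> ennreal (L + 4 * t + 4 * t)" by (rule rho_le_trans[OF 1 pv(2)]) (use t L in auto)
        then have "\<rho> a y \<le> ennreal (L + 4 * t + 4 * t + L)"
          by (rule rho_le_trans[OF _ bd[OF pv(3)]]) (use t L in auto)
        then have "\<rho> a z \<le> ennreal (L + 4 * t + 4 * t + L + 4 * t)"
          by (rule rho_le_trans[OF _ step.hyps(4)]) (use t L in auto)
        then have "\<rho> a b \<le> ennreal (L + 4 * t + 4 * t + L + 4 * t + (L + 4 * t))"
          by (rule rho_le_trans[OF _ 2]) (use t L in auto)
        \<comment> \<open>This detour from one cap through a component of \<open>S\<close> to
          another cap is where the sparsity constant comes from; a direct step between caps needs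
          less.\<close>
        then have "\<rho> a b \<le> ennreal (3 * L + 16 * t)" by (rule rho_le_mono) (use t L in simp)
        then show ?thesis using sparse \<open>a \<in> A\<close> \<open>b \<in> A\<close> by blast
      qed
      then show ?thesis using 2 by blast
    qed
  qed
  have dist: "\<rho> a y \<le> ennreal (2 * L + 8 * t)"
    if "(u, y) \<in> chain \<rho> ?S' (4 * t)" "u \<in> cap t S a" "a \<in> A" for u y a
    using near[OF that]
  proof
    assume y: "y \<in> cap t S a"
    have "\<rho> a y \<le> ennreal (L + 4 * t)" by (rule cap_bounded[OF t L bd y])
    then show ?thesis by (rule rho_le_mono) (use t L in simp)
  next
    assume "\<exists>p\<in>S. \<exists>v\<in>cap t S a. \<rho> v p \<le> ennreal (4 * t) \<and> (p, y) \<in> chain \<rho> S (4 * t)"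
    then obtain p v where pv: "v \<in> cap t S a" "\<rho> v p \<le> ennreal (4 * t)" "(p, y) \<in> chain \<rho> S (4 * t)"
      by blast
    have 1: "\<rho> a v \<le> ennreal (L + 4 * t)" by (rule cap_bounded[OF t L bd pv(1)])
    have "\<rho> a p \<le> ennreal (L + 4 * t + 4 * t)" by (rule rho_le_trans[OF 1 pv(2)]) (use t L in auto)
    then have "\<rho> a y \<le> ennreal (L + 4 * t + 4 * t + L)"
      by (rule rho_le_trans[OF _ bd[OF pv(3)]]) (use t L in auto)
    then show ?thesis by (rule rho_le_mono) simp
  qed
  from chain_Un_cases[OF xy] show ?thesis
  proof
    assume "(x, y) \<in> chain \<rho> S (4 * t)"
    then have "\<rho> x y \<le> ennreal L" by (rule bd)
    then show ?thesis by (rule rho_le_mono) (use t L in simp)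
  next
    assume "\<exists>u\<in>(\<Union>a\<in>A. cap t S a). (x, u) \<in> chain \<rho> ?S' (4 * t) \<and> (u, y) \<in> chain \<rho> ?S' (4 * t)"
    then obtain u a where u: "a \<in> A" "u \<in> cap t S a" "(u, x) \<in> chain \<rho> ?S' (4 * t)"
        "(u, y) \<in> chain \<rho> ?S' (4 * t)"
      using chain_sym by blast
    have "\<rho> x a \<le> ennreal (2 * L + 8 * t)" using dist[OF u(3,2,1)] rho_sym by simp
    then show ?thesis by (rule rho_le_trans[OF _ dist[OF u(4,2,1)]]) (use t L in auto)
  qed
qed

primrec stage :: "real \<Rightarrow> (nat \<Rightarrow> 'a set) \<Rightarrow> nat \<Rightarrow> 'a set" where
  "stage t A 0 = {}"
| "stage t A (Suc n) = stage t A n \<union> (\<Union>a\<in>A n. cap t (stage t A n) a)"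

end

primrec stage_bound :: "real \<Rightarrow> nat \<Rightarrow> real" where
  "stage_bound t 0 = 0"
| "stage_bound t (Suc n) = 4 * stage_bound t n + 16 * t"

lemma stage_bound_nonneg: "0 \<le> t \<Longrightarrow> 0 \<le> stage_bound t n"
  by (induction n) auto

text \<open>The sparsity demanded by \<open>cap_chain_bounded\<close> at stage \<open>n\<close>. It
  does not refer to the sets \<open>A n\<close>, so it can be prescribed before they are
  selected.\<close>

definition sparse_gap :: "real \<Rightarrow> nat \<Rightarrow> real" where
  "sparse_gap t n = 3 * stage_bound t n + 16 * t"

context enumerated_metric
begin

lemma borel_cap_UN:
  assumes [measurable]: "S \<in> sets borel" "A \<in> sets borel"
  shows "(\<Union>a\<in>A. cap t S a) \<in> sets borel"
proof -
  have cap_iff: "y \<in> cap t S a \<longleftrightarrow> y = a \<or> (\<exists>i. f i a \<in> S \<and> \<rho> a (f i a) \<le> ennreal (2 * t) \<and>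
      (\<exists>j. f j y \<in> S \<and> (f i a, f j y) \<in> chain \<rho> S (4 * t) \<and> \<rho> (f j y) y \<le> ennreal (2 * t)))" for y a
  proof -
    have "y \<in> cap t S a \<longleftrightarrow> y = a \<or> (\<exists>p. \<rho> a p < \<infinity> \<and> p \<in> S \<and> \<rho> a p \<le> ennreal (2 * t) \<and>
      (\<exists>q. \<rho> y q < \<infinity> \<and> q \<in> S \<and> (p, q) \<in> chain \<rho> S (4 * t) \<and> \<rho> q y \<le> ennreal (2 * t)))"
    proof -
      have "\<rho> a p < \<infinity>" if "\<rho> a p \<le> ennreal (2 * t)" for p using that by (rule rho_le_finite)
      moreover have "\<rho> y q < \<infinity>" if "\<rho> q y \<le> ennreal (2 * t)" for q
        using rho_le_finite[OF that] rho_sym[of q y] by simp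
      ultimately show ?thesis unfolding cap_def by blast
    qed
    then show ?thesis unfolding ex_class .
  qed
  have "(\<Union>a\<in>A. cap t S a) = {y. \<exists>a. \<rho> y a < \<infinity> \<and> a \<in> A \<and> y \<in> cap t S a}"
  proof -
    have "\<rho> y a < \<infinity>" if y: "y \<in> cap t S a" for y a
    proof (cases "y = a")
      case False
      then obtain p q where pq: "\<rho> a p \<le> ennreal (2 * t)" "(p, q) \<in> chain \<rho> S (4 * t)"
          "\<rho> q y \<le> ennreal (2 * t)"
        using y unfolding cap_def by blast
      then have "\<rho> a y < \<infinity>"
        using rho_finite_trans rho_le_finite chain_finite by blast
      then show ?thesis using rho_sym by simp
    qed simp
    then show ?thesis by blast
  qed
  also have "\<dots> = {y. \<exists>k. f k y \<in> A \<and> y \<in> cap t S (f k y)}"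
    unfolding ex_class ..
  also have "\<dots> \<in> sets borel"
    unfolding cap_iff by measurable
  finally show ?thesis .
qed

lemma borel_stage:
  assumes "\<And>n. A n \<in> sets borel"
  shows "stage t A n \<in> sets borel"
  by (induction n) (auto intro: borel_cap_UN assms)

lemma stage_mono: "m \<le> n \<Longrightarrow> stage t A m \<subseteq> stage t A n"
  by (rule lift_Suc_mono_le[of "stage t A"]) auto

lemma stage_bounded:
  assumes t: "0 \<le> t"
    and sparse: "\<And>n a b. a \<in> A n \<Longrightarrow> b \<in> A n \<Longrightarrow> \<rho> a b \<le> ennreal (sparse_gap t n) \<Longrightarrow> a = b"
  shows "(x, y) \<in> chain \<rho> (stage t A n) (4 * t) \<Longrightarrow> \<rho> x y \<le> ennreal (stage_bound t n)"
proof (induction n arbitrary: x y)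
  case 0
  then show ?case using chain_in_or_eq by fastforce
next
  case (Suc n)
  have "\<rho> x y \<le> ennreal (4 * stage_bound t n + 16 * t)"
    by (rule cap_chain_bounded[OF t stage_bound_nonneg[OF t], of "stage t A n" n "A n"])
      (use Suc sparse in \<open>auto simp: sparse_gap_def\<close>)
  then show ?case by simp
qed

text \<open>
  The pieces \<open>cap t (stage t A n) a\<close> form a toast: a piece of an earlier stage is either contained in
  one of stage \<open>n\<close> together with its \<open>2t\<close>-neighbourhood, or is \<open>2t\<close>-far from it. Hence the inner
  boundaries of different stages are far apart, and they separate everything else into finite parts.
\<close>

theorem finite_components_cover:
  assumes t: "0 \<le> t" and A: "\<And>n. A n \<in> sets borel"
    and sparse: "\<And>n a b. a \<in> A n \<Longrightarrow> b \<in> A n \<Longrightarrow> \<rho> a b \<le> ennreal (sparse_gap t n) \<Longrightarrow> a = b"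
  shows "\<exists>U\<in>sets borel. (\<forall>x. finite {y. (x, y) \<in> chain \<rho> U t}) \<and>
    (\<forall>x. finite {y. (x, y) \<in> chain \<rho> ((\<Union>n. A n) - U) t})"
proof -
  define c where "c n a = cap t (stage t A n) a" for n a
  define T where "T n = (\<Union>a\<in>A n. c n a)" for n
  define edge where "edge n = {y \<in> T n. \<exists>z. z \<notin> T n \<and> \<rho> y z \<le> ennreal t}" for n
  define U where "U = (\<Union>n. edge n)"
  have L: "0 \<le> stage_bound t n" for n by (rule stage_bound_nonneg[OF t])
  have bd: "(x, y) \<in> chain \<rho> (stage t A n) (4 * t) \<Longrightarrow> \<rho> x y \<le> ennreal (stage_bound t n)" for n x y
    by (rule stage_bounded[OF t sparse])
  have Tm[measurable]: "T n \<in> sets borel" for n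
    unfolding T_def c_def by (intro borel_cap_UN borel_stage A)
  have T_stage: "T k \<subseteq> stage t A n" if "k < n" for k n
  proof -
    have "T k \<subseteq> stage t A (Suc k)" unfolding T_def c_def by auto
    then show ?thesis using stage_mono[of "Suc k" n t A] that by auto
  qed
  have c_finite: "finite (c n a)" for n a
  proof -
    have "c n a \<subseteq> {y. \<rho> a y \<le> ennreal (stage_bound t n + 4 * t)}"
      unfolding c_def using cap_bounded[OF t L bd] by blast
    then show ?thesis using finite_bounded finite_subset by blast
  qed
  have c_sep: "a = b" if "a \<in> A n" "b \<in> A n" "y \<in> c n a" "z \<in> c n b" "\<rho> y z \<le> ennreal t" for a b n y z
  proof -
    have "\<rho> y z \<le> ennreal (4 * t)" using that(5) by (rule rho_le_mono) (use t in simp)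
    show ?thesis
      by (rule cap_separated[where S = "stage t A n" and A = "A n", OF t L bd _ that(1,2)
            that(3,4)[unfolded c_def] \<open>\<rho> y z \<le> ennreal (4 * t)\<close>])
        (use sparse in \<open>auto simp: sparse_gap_def\<close>)
  qed
  \<comment> \<open>The earlier edge point \<open>y'\<close> belongs to the set on which stage
    \<open>n\<close> is built and is close to the piece, so the piece absorbs its
    \<open>2t\<close>-neighbourhood. That contains \<open>z\<close>, which was to lie outside
    \<open>T n\<close>.\<close>
  have far: False if far: "y \<in> edge n" "y' \<in> edge k" "\<rho> y y' \<le> ennreal t" "k < n" for y y' n k
  proof -
    have y': "y' \<in> stage t A n" using far(2) T_stage[OF far(4)] unfolding edge_def by blast
    obtain a z where az: "a \<in> A n" "y \<in> c n a" "z \<notin> T n" "\<rho> y z \<le> ennreal t"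
      using far(1) unfolding edge_def T_def by auto
    have "\<rho> y' y \<le> ennreal t" using far(3) rho_sym by simp
    then have "\<rho> y' z \<le> ennreal (2 * t)" by (rule rho_le_trans[OF _ az(4)]) (use t in auto)
    moreover have "\<rho> y y' \<le> ennreal (2 * t)" using far(3) by (rule rho_le_mono) (use t in simp)
    ultimately have "z \<in> c n a"
      using cap_absorbs[OF t y' az(2)[unfolded c_def]] unfolding c_def by (metis chain_refl)
    then show False using az(1,3) unfolding T_def by blast
  qed
  have "U \<in> sets borel"
  proof -
    have "edge n = {y. y \<in> T n \<and> (\<exists>i. f i y \<notin> T n \<and> \<rho> y (f i y) \<le> ennreal t)}" for n
    proof -
      have "(\<exists>z. z \<notin> T n \<and> \<rho> y z \<le> ennreal t) \<longleftrightarrow> (\<exists>z. \<rho> y z < \<infinity> \<and> z \<notin> T n \<and> \<rho> y z \<le> ennreal t)" for y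
        using rho_le_finite by blast
      then show ?thesis unfolding edge_def ex_class by simp
    qed
    also have "{y. y \<in> T n \<and> (\<exists>i. f i y \<notin> T n \<and> \<rho> y (f i y) \<le> ennreal t)} \<in> sets borel" for n
      by measurable
    finally have "edge n \<in> sets borel" for n .
    then show ?thesis unfolding U_def by blast
  qed
  moreover have "finite {y. (x, y) \<in> chain \<rho> U t}" for x
  proof (cases "x \<in> U")
    case True
    then obtain n a where n: "x \<in> edge n" "a \<in> A n" "x \<in> c n a" unfolding U_def edge_def T_def by blast
    \<comment> \<open>A chain in \<open>U\<close> can change neither the stage, by
      \<open>far\<close> in both directions, nor the piece within the stage, by
      \<open>c_sep\<close>.\<close>
    have "y \<in> edge n \<and> y \<in> c n a" if "(x, y) \<in> chain \<rho> U t" for y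
      using that
    proof (induction rule: chain_induct)
      case (step y z)
      then obtain k where k: "z \<in> edge k" unfolding U_def by blast
      have "\<rho> z y \<le> ennreal t" using step rho_sym by simp
      then have "k = n" using far[of y n z k] far[of z k y n] k step by (meson linorder_neqE_nat)
      then obtain b where b: "b \<in> A n" "z \<in> c n b" using k unfolding edge_def T_def by auto
      then have "a = b" using c_sep[OF n(2) b(1) _ b(2)] step by blast
      then show ?case using k b \<open>k = n\<close> by blast
    qed (use n in simp)
    then have "{y. (x, y) \<in> chain \<rho> U t} \<subseteq> c n a" by blast
    then show ?thesis using c_finite finite_subset by blast
  next
    case False
    then have "{y. (x, y) \<in> chain \<rho> U t} \<subseteq> {x}" using chain_in_or_eq by fastforce
    then show ?thesis using finite_subset by blast
  qed
  moreover have "finite {y. (x, y) \<in> chain \<rho> ((\<Union>n. A n) - U) t}" for x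
  proof (cases "x \<in> (\<Union>n. A n) - U")
    case True
    then obtain n where n: "x \<in> A n" by blast
    \<comment> \<open>The centre \<open>x\<close> starts inside its own piece. Leaving
      \<open>T n\<close> would require a step from a point of \<open>edge n\<close>, which lies in
      \<open>U\<close>, and entering another piece of stage \<open>n\<close> is excluded by
      \<open>c_sep\<close>.\<close>
    have "y \<in> c n x" if "(x, y) \<in> chain \<rho> ((\<Union>n. A n) - U) t" for y
      using that
    proof (induction rule: chain_induct)
      case refl
      then show ?case by (simp add: c_def)
    next
      case (step y z)
      have "y \<in> T n" using step n unfolding T_def by blast
      then have "z \<in> T n" using step unfolding U_def edge_def by blast
      then obtain b where b: "b \<in> A n" "z \<in> c n b" unfolding T_def by blast
      then have "x = b" using c_sep[OF n b(1) _ b(2)] step by blast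
      then show ?case using b by blast
    qed
    then have "{y. (x, y) \<in> chain \<rho> ((\<Union>n. A n) - U) t} \<subseteq> c n x" by blast
    then show ?thesis using c_finite finite_subset by blast
  next
    case False
    then have "{y. (x, y) \<in> chain \<rho> ((\<Union>n. A n) - U) t} \<subseteq> {x}" using chain_in_or_eq by fastforce
    then show ?thesis using finite_subset by blast
  qed
  ultimately show ?thesis by blast
qed

end

section \<open>Colourings and asymptotic dimension\<close>

definition bounded_colouring ::
  "('a \<Rightarrow> 'a \<Rightarrow> ennreal) \<Rightarrow> 'a set \<Rightarrow> nat \<Rightarrow> real \<Rightarrow> real \<Rightarrow> ('a \<Rightarrow> nat) \<Rightarrow> bool" where
  "bounded_colouring \<rho> X d s D c \<longleftrightarrow>
     (\<forall>x. c x \<le> d) \<and> (\<forall>i x y. (x, y) \<in> chain \<rho> (X \<inter> c -` {i}) s \<longrightarrow> \<rho> x y \<le> ennreal D)"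

lemma bounded_colouring_subset:
  assumes "bounded_colouring \<rho> X d s D c" "Y \<subseteq> X"
  shows "bounded_colouring \<rho> Y d s D c"
proof -
  have "chain \<rho> (Y \<inter> c -` {i}) s \<subseteq> chain \<rho> (X \<inter> c -` {i}) s" for i
    by (rule chain_mono) (use assms(2) in auto)
  then show ?thesis using assms(1) unfolding bounded_colouring_def by blast
qed

text \<open>The codes are decision lists whose tests are membership in basic open sets. They are
  countable in number and interpolate any function on a finite set, which turns the choice of a
  colouring into the choice of a number.\<close>

lemma borel_colour_codes:
  obtains \<phi> :: "nat \<Rightarrow> 'a::{t1_space,second_countable_topology} \<Rightarrow> nat"
  where "\<And>q. \<phi> q \<in> measurable borel (count_space UNIV)"
    "\<And>F c. finite F \<Longrightarrow> \<exists>q. \<forall>x\<in>F. \<phi> q x = c x"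
proof -
  obtain V :: "nat \<Rightarrow> 'a set" where V: "\<And>k. open (V k)"
      "\<And>x U. open U \<Longrightarrow> x \<in> U \<Longrightarrow> \<exists>k. x \<in> V k \<and> V k \<subseteq> U"
    using countable_base_sequence by blast
  have [measurable]: "V k \<in> sets borel" for k using V(1) by simp
  define \<psi> :: "(nat \<times> nat) list \<Rightarrow> 'a \<Rightarrow> nat" where
    "\<psi> l x = foldr (\<lambda>(k, i) r. if x \<in> V k then i else r) l 0" for l x
  have [simp]: "\<psi> ((k, i) # l) x = (if x \<in> V k then i else \<psi> l x)" for k i l x
    by (simp add: \<psi>_def)
  have meas: "\<psi> l \<in> measurable borel (count_space UNIV)" for l
  proof (induction l)
    case Nil
    then show ?case by (simp add: \<psi>_def)
  next
    case (Cons p l)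
    note Cons[measurable]
    obtain k i where "p = (k, i)" by (cases p)
    moreover have "(\<lambda>x. if x \<in> V k then i else \<psi> l x) \<in> measurable borel (count_space UNIV)"
      by measurable
    ultimately show ?case by (simp cong: measurable_cong)
  qed
  have interp: "\<exists>l. \<forall>x\<in>F. \<psi> l x = c x" if "finite F" for F c
    using that
  proof (induction F rule: finite_induct)
    case (insert a F)
    then obtain l where l: "\<forall>x\<in>F. \<psi> l x = c x" by blast
    obtain k where k: "a \<in> V k" "V k \<inter> F \<subseteq> {a}"
      using base_isolates_finite[OF V(2) insert.hyps(1)] by blast
    \<comment> \<open>The new test stands at the head of the list and fires at \<open>a\<close> but
      nowhere on \<open>F\<close>, so the earlier values survive.\<close>
    have "\<forall>x\<in>insert a F. \<psi> ((k, c a) # l) x = c x" using l k insert.hyps by auto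
    then show ?case by blast
  qed simp
  show ?thesis
  proof
    show "\<psi> (from_nat q) \<in> measurable borel (count_space UNIV)" for q by (rule meas)
    show "\<exists>q. \<forall>x\<in>F. \<psi> (from_nat q) x = c x" if "finite F" for F c
      using interp[OF that, of c] by (metis from_nat_to_nat)
  qed
qed

context enumerated_metric
begin

text \<open>Every \<open>t\<close>-component uses its least valid code. Validity depends only on the
  component, so the code is constant there. Because \<open>s \<le> t\<close>, monochromatic
  \<open>s\<close>-chains stay in one component, where validity bounds them.\<close>

lemma borel_colouring:
  assumes U[measurable]: "U \<in> sets borel" and fin: "\<And>x. finite {y. (x, y) \<in> chain \<rho> U t}"
    and st: "s \<le> t" and c0: "bounded_colouring \<rho> U d s D c0"
  obtains c where "c \<in> measurable borel (count_space UNIV)" "bounded_colouring \<rho> U d s D c"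
proof -
  obtain \<phi> :: "nat \<Rightarrow> 'a \<Rightarrow> nat" where \<phi>[measurable]: "\<And>q. \<phi> q \<in> measurable borel (count_space UNIV)"
    and interp: "\<And>F c. finite F \<Longrightarrow> \<exists>q. \<forall>x\<in>F. \<phi> q x = c x"
    using borel_colour_codes by blast
  define valid where "valid q x \<longleftrightarrow> (\<forall>y. (x, y) \<in> chain \<rho> U t \<longrightarrow> \<phi> q y \<le> d \<and>
    (\<forall>z i. (y, z) \<in> chain \<rho> (U \<inter> \<phi> q -` {i}) s \<longrightarrow> \<rho> y z \<le> ennreal D))" for q x
  define qq where "qq x = (LEAST q. valid q x)" for x
  define c where "c x = \<phi> (qq x) x" for x
  have local: "(x, y) \<in> chain \<rho> (U \<inter> S \<inter> {y. (w, y) \<in> chain \<rho> U t}) s"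
    if "(x, y) \<in> chain \<rho> (U \<inter> S) s" "(w, x) \<in> chain \<rho> U t" for x y S w
  proof -
    have "(x, y) \<in> chain \<rho> (U \<inter> S \<inter> {y. (w, y) \<in> chain \<rho> U t}) s \<and> y \<in> {y. (w, y) \<in> chain \<rho> U t}"
    proof (rule chain_invariant[OF that(1)])
      show "x \<in> {y. (w, y) \<in> chain \<rho> U t}" using that(2) by simp
      fix y z
      assume yz: "y \<in> U \<inter> S \<inter> {y. (w, y) \<in> chain \<rho> U t}" "z \<in> U \<inter> S" "\<rho> y z \<le> ennreal s"
      then have "\<rho> y z \<le> ennreal t" using st rho_le_mono by blast
      then show "z \<in> {y. (w, y) \<in> chain \<rho> U t}" using yz by (blast intro: chain_step)
    qed
    then show ?thesis ..
  qed
  have ex: "\<exists>q. valid q x" for x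
  proof -
    let ?F = "{y. (x, y) \<in> chain \<rho> U t}"
    obtain q where q: "\<forall>y\<in>?F. \<phi> q y = c0 y" using interp[OF fin] by blast
    have "\<rho> y z \<le> ennreal D" if y: "(x, y) \<in> chain \<rho> U t" and yz: "(y, z) \<in> chain \<rho> (U \<inter> \<phi> q -` {i}) s" for y z i
    proof -
      have "(y, z) \<in> chain \<rho> (U \<inter> \<phi> q -` {i} \<inter> ?F) s" by (rule local[OF yz y])
      moreover have "U \<inter> \<phi> q -` {i} \<inter> ?F \<subseteq> U \<inter> c0 -` {i}" using q by auto
      ultimately have "(y, z) \<in> chain \<rho> (U \<inter> c0 -` {i}) s" using chain_mono by blast
      then show ?thesis using c0 unfolding bounded_colouring_def by blast
    qed
    moreover have "\<phi> q y \<le> d" if "(x, y) \<in> chain \<rho> U t" for y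
      using q that c0 unfolding bounded_colouring_def by simp
    ultimately have "valid q x" unfolding valid_def by blast
    then show ?thesis ..
  qed
  have valid_qq: "valid (qq x) x" for x unfolding qq_def using ex by (rule LeastI_ex)
  have qq_cong: "qq x = qq y" if "(x, y) \<in> chain \<rho> U t" for x y
  proof -
    have "(x, z) \<in> chain \<rho> U t \<longleftrightarrow> (y, z) \<in> chain \<rho> U t" for z
      using that chain_sym chain_trans by meson
    then have "valid q x \<longleftrightarrow> valid q y" for q unfolding valid_def by simp
    then show ?thesis unfolding qq_def by simp
  qed
  \<comment> \<open>All points quantified over lie in the class of \<open>x\<close>, so validity is
    a countable Boolean combination of Borel conditions.\<close>
  have valid_iff: "valid q x \<longleftrightarrow> (\<forall>n. (x, f n x) \<in> chain \<rho> U t \<longrightarrow> \<phi> q (f n x) \<le> d \<and>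
    (\<forall>m i. (f n x, f m (f n x)) \<in> chain \<rho> (U \<inter> \<phi> q -` {i}) s \<longrightarrow> \<rho> (f n x) (f m (f n x)) \<le> ennreal D))" for q x
  proof -
    have inner: "(\<forall>z i. (y, z) \<in> chain \<rho> (U \<inter> \<phi> q -` {i}) s \<longrightarrow> \<rho> y z \<le> ennreal D) \<longleftrightarrow>
      (\<forall>m i. (y, f m y) \<in> chain \<rho> (U \<inter> \<phi> q -` {i}) s \<longrightarrow> \<rho> y (f m y) \<le> ennreal D)" for y
      using chain_finite enum by metis
    show ?thesis unfolding valid_def inner using chain_finite enum by metis
  qed
  have [measurable]: "U \<inter> \<phi> q -` {i} \<in> sets borel" for q i
  proof -
    have "{x. x \<in> U \<and> \<phi> q x = i} \<in> sets borel" by measurable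
    moreover have "{x. x \<in> U \<and> \<phi> q x = i} = U \<inter> \<phi> q -` {i}" by auto
    ultimately show ?thesis by simp
  qed
  have [measurable]: "Measurable.pred borel (\<lambda>x. valid q x)" for q
    unfolding valid_iff by measurable
  have [measurable]: "qq \<in> measurable borel (count_space UNIV)"
    unfolding qq_def by measurable
  have "c \<in> measurable borel (count_space UNIV)"
    unfolding c_def by (rule measurable_compose_countable) measurable
  moreover have "bounded_colouring \<rho> U d s D c"
    unfolding bounded_colouring_def
  proof (intro conjI allI impI)
    show "c x \<le> d" for x
      using valid_qq[of x] unfolding valid_def c_def by simp
    fix i x y assume xy: "(x, y) \<in> chain \<rho> (U \<inter> c -` {i}) s"
    let ?F = "{y. (x, y) \<in> chain \<rho> U t}"
    have "(x, y) \<in> chain \<rho> (U \<inter> c -` {i} \<inter> ?F) s" by (rule local[OF xy]) simp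
    moreover have "U \<inter> c -` {i} \<inter> ?F \<subseteq> U \<inter> \<phi> (qq x) -` {i}"
      using qq_cong unfolding c_def by auto
    ultimately have "(x, y) \<in> chain \<rho> (U \<inter> \<phi> (qq x) -` {i}) s" using chain_mono by blast
    then show "\<rho> x y \<le> ennreal D" using valid_qq[of x] unfolding valid_def by (metis chain_refl)
  qed
  ultimately show ?thesis by (rule that)
qed

text \<open>An excursion from \<open>W\<close> into \<open>V\<close> and back costs at most
  \<open>s + D + s\<close>, so the points of \<open>W\<close> visited by an \<open>s\<close>-chain
  form an \<open>s1\<close>-chain in \<open>W\<close>. A last excursion that does not return adds
  \<open>s + D\<close>, and the factor 2 measures both ends from a common point of
  \<open>W\<close>.\<close>

lemma chain_Un_bounded:
  assumes s: "0 \<le> s" and D: "0 \<le> D" and D1: "0 \<le> D1" and s1: "D + 2 * s \<le> s1"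
    and V: "\<And>x y. (x, y) \<in> chain \<rho> V s \<Longrightarrow> \<rho> x y \<le> ennreal D"
    and W: "\<And>x y. (x, y) \<in> chain \<rho> W s1 \<Longrightarrow> \<rho> x y \<le> ennreal D1"
    and xy: "(x, y) \<in> chain \<rho> (V \<union> W) s"
  shows "\<rho> x y \<le> ennreal (2 * (D1 + s + D))"
proof -
  \<comment> \<open>Here \<open>w\<close> is the last point of \<open>W\<close> visited; since then
    the chain has run inside \<open>V\<close>.\<close>
  have near: "\<exists>w\<in>W. (u, w) \<in> chain \<rho> W s1 \<and> (y = w \<or> (\<exists>v\<in>V. \<rho> w v \<le> ennreal s \<and> (v, y) \<in> chain \<rho> V s))"
    if "(u, y) \<in> chain \<rho> (V \<union> W) s" "u \<in> W" for u y
    using that(1)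
  proof (induction rule: chain_induct)
    case refl
    then show ?case using that(2) by (intro bexI[of _ u]) auto
  next
    case (step y z)
    then obtain w where w: "w \<in> W" "(u, w) \<in> chain \<rho> W s1"
      "y = w \<or> (\<exists>v\<in>V. \<rho> w v \<le> ennreal s \<and> (v, y) \<in> chain \<rho> V s)" by blast
    show ?case
    proof (cases "z \<in> W")
      case True
      have "\<rho> w z \<le> ennreal s1"
        using w(3)
      proof
        assume "y = w"
        then have "\<rho> w z \<le> ennreal s" using step by simp
        then show ?thesis by (rule rho_le_mono) (use s D s1 in simp)
      next
        assume "\<exists>v\<in>V. \<rho> w v \<le> ennreal s \<and> (v, y) \<in> chain \<rho> V s"
        then obtain v where v: "\<rho> w v \<le> ennreal s" "(v, y) \<in> chain \<rho> V s" by blast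
        have "\<rho> w y \<le> ennreal (s + D)" by (rule rho_le_trans[OF v(1) V[OF v(2)]]) (use s D in auto)
        then show ?thesis by (rule rho_le_trans[OF _ step.hyps(4)]) (use s D s1 in auto)
      qed
      then have "(u, z) \<in> chain \<rho> W s1" using w True by (blast intro: chain_step)
      then show ?thesis using True by blast
    next
      case False
      then have z: "z \<in> V" using step by blast
      have "\<exists>v\<in>V. \<rho> w v \<le> ennreal s \<and> (v, z) \<in> chain \<rho> V s"
        using w(3)
      proof
        assume "y = w"
        then show ?thesis using z step by (metis chain_refl)
      next
        assume "\<exists>v\<in>V. \<rho> w v \<le> ennreal s \<and> (v, y) \<in> chain \<rho> V s"
        then show ?thesis using z step by (meson chain_in chain_step)
      qed
      then show ?thesis using w by blast
    qed
  qed
  have dist: "\<rho> u y \<le> ennreal (D1 + s + D)" if uy: "(u, y) \<in> chain \<rho> (V \<union> W) s" "u \<in> W" for u y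
  proof -
    obtain w where w: "(u, w) \<in> chain \<rho> W s1"
      "y = w \<or> (\<exists>v\<in>V. \<rho> w v \<le> ennreal s \<and> (v, y) \<in> chain \<rho> V s)"
      using near[OF uy] by blast
    from w(2) show ?thesis
    proof
      assume "y = w"
      then have "\<rho> u y \<le> ennreal D1" using W[OF w(1)] by simp
      then show ?thesis by (rule rho_le_mono) (use s D in simp)
    next
      assume "\<exists>v\<in>V. \<rho> w v \<le> ennreal s \<and> (v, y) \<in> chain \<rho> V s"
      then obtain v where v: "\<rho> w v \<le> ennreal s" "(v, y) \<in> chain \<rho> V s" by blast
      have "\<rho> u v \<le> ennreal (D1 + s)" by (rule rho_le_trans[OF W[OF w(1)] v(1)]) (use s D1 in auto)
      then show ?thesis by (rule rho_le_trans[OF _ V[OF v(2)]]) (use s D D1 in auto)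
    qed
  qed
  from chain_Un_cases[OF xy] show ?thesis
  proof
    assume "(x, y) \<in> chain \<rho> V s"
    then have "\<rho> x y \<le> ennreal D" by (rule V)
    then show ?thesis by (rule rho_le_mono) (use s D D1 in simp)
  next
    assume "\<exists>u\<in>W. (x, u) \<in> chain \<rho> (V \<union> W) s \<and> (u, y) \<in> chain \<rho> (V \<union> W) s"
    then obtain u where u: "u \<in> W" "(u, x) \<in> chain \<rho> (V \<union> W) s" "(u, y) \<in> chain \<rho> (V \<union> W) s"
      using chain_sym by blast
    have "\<rho> x u \<le> ennreal (D1 + s + D)" using dist[OF u(2,1)] rho_sym by simp
    then show ?thesis by (rule rho_le_trans[OF _ dist[OF u(3,1)]]) (use s D D1 in auto)
  qed
qed

text \<open>
  The colour of a point is a scale at which enlarging the ball by \<open>s\<close> meets no new class: along a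
  monochromatic chain the set of classes met is then constant.
\<close>

lemma asdim_bound_imp_colouring:
  assumes bound: "asdim_bound \<R> X \<rho> d" and s: "0 < s"
  obtains D c where "0 \<le> D" "bounded_colouring \<rho> X d s D c"
proof -
  \<comment> \<open>The \<open>d + 2\<close> nested sets \<open>N 0 x\<close>, ...,
    \<open>N (d + 1) x\<close> have between 1 and \<open>d + 1\<close> elements, so two consecutive
    ones agree at some index \<open>j \<le> d\<close>. This radius thus yields exactly the colours 0
    to \<open>d\<close>.\<close>
  have "0 < real (Suc d) * s" using s by simp
  then obtain E where E: "equiv X E" "uniformly_bounded X \<rho> E"
    and balls: "\<forall>y\<in>X. finite {C \<in> X // E. C \<inter> rho_ball X \<rho> y (real (Suc d) * s) \<noteq> {}} \<and>
      card {C \<in> X // E. C \<inter> rho_ball X \<rho> y (real (Suc d) * s) \<noteq> {}} \<le> d + 1"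
    using bound unfolding asdim_bound_def by blast
  obtain K where K: "\<forall>C\<in>X // E. rho_diameter \<rho> C \<le> ennreal K"
    using E(2) unfolding uniformly_bounded_def by blast
  define N where "N j x = {C \<in> X // E. C \<inter> rho_ball X \<rho> x (real j * s) \<noteq> {}}" for j x
  have N_mono: "N i x \<subseteq> N j x" if "i \<le> j" for i j x
  proof -
    have "real i * s \<le> real j * s" using that s by simp
    then have "rho_ball X \<rho> x (real i * s) \<subseteq> rho_ball X \<rho> x (real j * s)"
      unfolding rho_ball_def using rho_le_mono by blast
    then show ?thesis unfolding N_def by blast
  qed
  have N_step: "N j y \<subseteq> N (Suc j) z" if "\<rho> y z \<le> ennreal s" for j y z
  proof -
    have "rho_ball X \<rho> y (real j * s) \<subseteq> rho_ball X \<rho> z (real (Suc j) * s)"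
    proof
      fix w assume w: "w \<in> rho_ball X \<rho> y (real j * s)"
      have "\<rho> z y \<le> ennreal s" using that rho_sym by simp
      moreover have "\<rho> y w \<le> ennreal (real j * s)" using w unfolding rho_ball_def by simp
      ultimately have "\<rho> z w \<le> ennreal (real (Suc j) * s)"
        by (rule rho_le_trans) (use s in \<open>auto simp: algebra_simps\<close>)
      then show "w \<in> rho_ball X \<rho> z (real (Suc j) * s)" using w unfolding rho_ball_def by simp
    qed
    then show ?thesis unfolding N_def by blast
  qed
  have stable: "\<exists>j\<le>d. N (Suc j) x = N j x" if x: "x \<in> X" for x
  proof (rule ccontr)
    assume neg: "\<not> (\<exists>j\<le>d. N (Suc j) x = N j x)"
    have fin: "finite (N (Suc d) x)" and le: "card (N (Suc d) x) \<le> d + 1"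
      using balls x unfolding N_def by blast+
    have "j < card (N j x)" if "j \<le> Suc d" for j
      using that
    proof (induction j)
      case 0
      have "E `` {x} \<in> N 0 x"
        using x equiv_class_self[OF E(1) x] unfolding N_def rho_ball_def
        by (auto simp: quotientI)
      moreover have "finite (N 0 x)" using finite_subset[OF N_mono fin] by simp
      ultimately show ?case by (auto simp: card_gt_0_iff)
    next
      case (Suc j)
      have "N j x \<subset> N (Suc j) x" using neg N_mono[of j "Suc j" x] Suc.prems by auto
      moreover have "finite (N (Suc j) x)" using finite_subset[OF N_mono[OF Suc.prems] fin] .
      ultimately have "card (N j x) < card (N (Suc j) x)" by (rule psubset_card_mono[rotated])
      then show ?case using Suc by simp
    qed
    from this[of "Suc d"] le show False by simp
  qed
  define c where "c x = (if x \<in> X then SOME j. j \<le> d \<and> N (Suc j) x = N j x else 0)" for x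
  have c: "c x \<le> d \<and> N (Suc (c x)) x = N (c x) x" if "x \<in> X" for x
    using someI_ex[OF stable[OF that, simplified]] that unfolding c_def by simp
  \<comment> \<open>The class of \<open>x\<close> is also met by the ball of radius
    \<open>i * s\<close> around \<open>y\<close>, with \<open>i \<le> d\<close>: one crosses this
    class and then goes to \<open>y\<close>. The maximum guards against a negative
    \<open>K\<close>.\<close>
  define D where "D = max K 0 + real d * s"
  have "\<rho> x y \<le> ennreal D" if xy: "(x, y) \<in> chain \<rho> (X \<inter> c -` {i}) s" for i x y
  proof (cases "x \<in> X \<inter> c -` {i}")
    case False
    then have "x = y" using chain_in_or_eq[OF xy] by blast
    then show ?thesis by simp
  next
    case True
    have "y \<in> X \<and> N i y = N i x"
      using xy
    proof (induction rule: chain_induct)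
      case refl
      then show ?case using True by simp
    next
      case (step y z)
      have "\<rho> z y \<le> ennreal s" using step rho_sym by simp
      \<comment> \<open>Enlarging either ball by \<open>s\<close> covers the other one, and at the
        common colour \<open>i\<close> such an enlargement meets no new class; this gives both
        inclusions.\<close>
      then have "N i y = N i z"
        using N_step[of y z i] N_step[of z y i] c[of y] c[of z] step by auto
      then show ?case using step by auto
    qed
    moreover have "E `` {x} \<in> N i x"
    proof -
      have "E `` {x} \<in> N 0 x"
        using True equiv_class_self[OF E(1), of x] unfolding N_def rho_ball_def
        by (auto simp: quotientI)
      then show ?thesis using N_mono[of 0 i x] by blast
    qed
    ultimately have "E `` {x} \<in> N i y" by simp
    then obtain w where w: "w \<in> E `` {x}" "\<rho> y w \<le> ennreal (real i * s)"
      unfolding N_def rho_ball_def by blast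
    have "x \<in> E `` {x}" using True equiv_class_self[OF E(1)] by blast
    then have "\<rho> x w \<le> rho_diameter \<rho> (E `` {x})"
      unfolding rho_diameter_def using w(1) by (meson SUP_upper2 order_refl)
    also have "\<dots> \<le> ennreal K" using K True by (auto simp: quotientI)
    also have "\<dots> \<le> ennreal (max K 0)" by (rule ennreal_leI) simp
    finally have xw: "\<rho> x w \<le> ennreal (max K 0)" .
    have "\<rho> w y \<le> ennreal (real i * s)" using w(2) rho_sym by simp
    moreover have "i \<le> d" using c[of x] True by auto
    ultimately show ?thesis
      unfolding D_def by (intro rho_le_trans[OF xw]) (use s in auto)
  qed
  moreover have "c x \<le> d" for x using c[of x] by (cases "x \<in> X") (auto simp: c_def)
  ultimately have "bounded_colouring \<rho> X d s D c" unfolding bounded_colouring_def by blast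
  moreover have "0 \<le> D" unfolding D_def using s by simp
  ultimately show ?thesis using that by blast
qed

text \<open>The classes are the monochromatic \<open>2r\<close>-components. Two points of a ball of
  radius \<open>r\<close> are at distance at most \<open>2r\<close>, so points of one colour share a
  class and the ball meets at most one class per colour.\<close>

lemma colouring_imp_asdim_bound:
  assumes X[measurable]: "X \<in> sets borel"
    and col: "\<And>r. 0 < r \<Longrightarrow> \<exists>D c. c \<in> measurable borel (count_space UNIV) \<and> bounded_colouring \<rho> X d (2 * r) D c"
  shows "asdim_bound (sets (restrict_space borel X \<Otimes>\<^sub>M restrict_space borel X)) X \<rho> d"
  unfolding asdim_bound_def
proof (intro allI impI)
  fix r :: real assume r: "0 < r"
  obtain D c where c[measurable]: "c \<in> measurable borel (count_space UNIV)"
    and bc: "bounded_colouring \<rho> X d (2 * r) D c"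
    using col[OF r] by blast
  define S where "S i = X \<inter> c -` {i}" for i
  \<comment> \<open>The factor \<open>S i \<times> S i\<close> removes the diagonal pairs outside
    \<open>S i\<close> that the reflexive \<open>chain\<close> carries.\<close>
  define E where "E = (\<Union>i. chain \<rho> (S i) (2 * r) \<inter> (S i \<times> S i))"
  have E_iff: "(x, y) \<in> E \<longleftrightarrow> x \<in> X \<and> y \<in> X \<and> c y = c x \<and> (x, y) \<in> chain \<rho> (S (c x)) (2 * r)" for x y
    unfolding E_def S_def by auto
  have S[measurable]: "S i \<in> sets borel" for i
  proof -
    have "{x. x \<in> X \<and> c x = i} \<in> sets borel" by measurable
    moreover have "{x. x \<in> X \<and> c x = i} = S i" unfolding S_def by auto
    ultimately show ?thesis by simp
  qed
  have "E = {p. \<exists>i. (fst p, snd p) \<in> chain \<rho> (S i) (2 * r) \<and> fst p \<in> S i \<and> snd p \<in> S i}"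
    unfolding E_def by auto
  also have "\<dots> \<in> sets borel" by measurable
  finally have E_borel: "E \<in> sets (borel \<Otimes>\<^sub>M borel)" unfolding borel_prod .
  let ?R = "restrict_space borel X"
  have space_R: "space ?R = X" by (simp add: space_restrict_space)
  have [measurable]: "(\<lambda>x. x) \<in> measurable ?R borel"
    by (rule measurable_restrict_space1) simp
  have "(\<lambda>p. (fst p, snd p)) \<in> measurable (?R \<Otimes>\<^sub>M ?R) (borel \<Otimes>\<^sub>M borel)"
    by (intro measurable_Pair measurable_compose[OF measurable_fst] measurable_compose[OF measurable_snd])
       measurable
  from measurable_sets[OF this E_borel]
  have "E \<inter> (X \<times> X) \<in> sets (?R \<Otimes>\<^sub>M ?R)"
    by (simp add: space_pair_measure space_R)
  moreover have "E \<inter> (X \<times> X) = E" using E_iff by auto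
  ultimately have "E \<in> sets (?R \<Otimes>\<^sub>M ?R)" by simp
  moreover have eq: "equiv X E"
  proof (rule equivI)
    show "E \<subseteq> X \<times> X" using E_iff by auto
    show "refl_on X E" unfolding refl_on_def using E_iff by auto
    show "sym E" unfolding sym_def E_iff using chain_sym by metis
    show "trans E" unfolding trans_def E_iff using chain_trans by metis
  qed
  moreover have "uniformly_bounded X \<rho> E"
    unfolding uniformly_bounded_def
  proof (intro exI ballI)
    fix C assume C: "C \<in> X // E"
    have "\<rho> x y \<le> ennreal D" if xy: "x \<in> C" "y \<in> C" for x y
    proof -
      have "(x, y) \<in> E" using C xy eq by (metis quotient_eq_iff)
      then show ?thesis using bc E_iff unfolding bounded_colouring_def S_def by blast
    qed
    then show "rho_diameter \<rho> C \<le> ennreal D"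
      unfolding rho_diameter_def by (intro SUP_least)
  qed
  moreover have "finite {C \<in> X // E. C \<inter> rho_ball X \<rho> y r \<noteq> {}} \<and>
      card {C \<in> X // E. C \<inter> rho_ball X \<rho> y r \<noteq> {}} \<le> d + 1" if "y \<in> X" for y
  proof -
    \<comment> \<open>One class for each colour, through an arbitrary representative in the ball; a
      colour absent from the ball gives an arbitrary value, which does not affect the count.\<close>
    define g where "g i = E `` {SOME w. w \<in> rho_ball X \<rho> y r \<and> c w = i}" for i
    have sub: "{C \<in> X // E. C \<inter> rho_ball X \<rho> y r \<noteq> {}} \<subseteq> g ` {..d}"
    proof
      fix C assume "C \<in> {C \<in> X // E. C \<inter> rho_ball X \<rho> y r \<noteq> {}}"
      then obtain w where C: "C \<in> X // E" and w: "w \<in> C" "w \<in> rho_ball X \<rho> y r" by blast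
      define v where "v = (SOME v. v \<in> rho_ball X \<rho> y r \<and> c v = c w)"
      have v: "v \<in> rho_ball X \<rho> y r" "c v = c w"
        using someI[of "\<lambda>v. v \<in> rho_ball X \<rho> y r \<and> c v = c w" w] w unfolding v_def by blast+
      have X': "v \<in> X" "w \<in> X" using v w unfolding rho_ball_def by auto
      have "\<rho> v y \<le> ennreal r" "\<rho> y w \<le> ennreal r"
        using v w rho_sym unfolding rho_ball_def by auto
      then have "\<rho> v w \<le> ennreal (2 * r)" by (rule rho_le_trans) (use r in auto)
      then have "(v, w) \<in> chain \<rho> (S (c v)) (2 * r)"
        using X' v(2) by (intro chain_single) (auto simp: S_def)
      then have "(v, w) \<in> E" using X' v(2) E_iff by simp
      then have "E `` {v} = E `` {w}" using equiv_class_eq[OF eq] by blast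
      also have "\<dots> = C" using C w(1) eq X'(2)
        by (metis Image_singleton_iff equiv_class_eq_iff quotientE)
      finally have "C = g (c w)" unfolding g_def v_def by simp
      moreover have "c w \<le> d" using bc unfolding bounded_colouring_def by blast
      ultimately show "C \<in> g ` {..d}" by blast
    qed
    have "card {C \<in> X // E. C \<inter> rho_ball X \<rho> y r \<noteq> {}} \<le> card (g ` {..d})"
      by (rule card_mono[OF _ sub]) simp
    also have "\<dots> \<le> d + 1" using card_image_le[of "{..d}" g] by simp
    finally show ?thesis using finite_subset[OF sub] by simp
  qed
  ultimately show "\<exists>E\<in>sets (?R \<Otimes>\<^sub>M ?R). equiv X E \<and> uniformly_bounded X \<rho> E \<and>
      (\<forall>y\<in>X. finite {C \<in> X // E. C \<inter> rho_ball X \<rho> y r \<noteq> {}} \<and>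
         card {C \<in> X // E. C \<inter> rho_ball X \<rho> y r \<noteq> {}} \<le> d + 1)" by blast
qed

text \<open>The scales are found in the order \<open>s\<close>, \<open>D\<close>, \<open>s1\<close>,
  \<open>D1\<close>, and only then is a cover of scale \<open>n \<ge> s1\<close> requested; it
  serves both colourings since \<open>s \<le> s1\<close>. Both use the same \<open>d + 1\<close>
  colours, so gluing them does not raise the dimension.\<close>

lemma asdim_Borel_eq_asdim:
  assumes X: "X \<in> sets borel"
    and cover: "\<And>n::nat. \<exists>U\<in>sets borel. (\<forall>x. finite {y. (x, y) \<in> chain \<rho> (X \<inter> U) (real n)}) \<and>
      (\<forall>x. finite {y. (x, y) \<in> chain \<rho> (X - U) (real n)})"
  shows "asdim_Borel (restrict_space borel X) \<rho> = asdim X \<rho>"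
proof -
  let ?B = "sets (restrict_space borel X \<Otimes>\<^sub>M restrict_space borel X)"
  have "asdim_bound ?B X \<rho> d \<longleftrightarrow> asdim_bound UNIV X \<rho> d" for d
  proof
    assume "asdim_bound ?B X \<rho> d"
    then show "asdim_bound UNIV X \<rho> d" unfolding asdim_bound_def by blast
  next
    assume bound: "asdim_bound UNIV X \<rho> d"
    show "asdim_bound ?B X \<rho> d"
    proof (rule colouring_imp_asdim_bound[OF X])
      fix r :: real assume r: "0 < r"
      define s where "s = 2 * r"
      have s: "0 < s" unfolding s_def using r by simp
      obtain D k where D: "0 \<le> D" and k: "bounded_colouring \<rho> X d s D k"
        using asdim_bound_imp_colouring[OF bound s] by blast
      define s1 where "s1 = D + 2 * s"
      have s1: "0 < s1" unfolding s1_def using s D by simp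
      obtain D1 k1 where D1: "0 \<le> D1" and k1: "bounded_colouring \<rho> X d s1 D1 k1"
        using asdim_bound_imp_colouring[OF bound s1] by blast
      obtain n :: nat where n: "s1 \<le> real n" using real_arch_simple by blast
      obtain U where U[measurable]: "U \<in> sets borel"
        and fin: "\<And>x. finite {y. (x, y) \<in> chain \<rho> (X \<inter> U) (real n)}"
          "\<And>x. finite {y. (x, y) \<in> chain \<rho> (X - U) (real n)}"
        using cover[of n] by blast
      have "s \<le> real n" using n s D unfolding s1_def by simp
      then obtain a where a[measurable]: "a \<in> measurable borel (count_space UNIV)"
          and ac: "bounded_colouring \<rho> (X \<inter> U) d s D a"
        using borel_colouring[OF sets.Int[OF X U] fin(1) _ bounded_colouring_subset[OF k]] by blast
      obtain b where b[measurable]: "b \<in> measurable borel (count_space UNIV)"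
          and bc: "bounded_colouring \<rho> (X - U) d s1 D1 b"
        using borel_colouring[OF sets.Diff[OF X U] fin(2) n bounded_colouring_subset[OF k1]] by blast
      define c where "c x = (if x \<in> U then a x else b x)" for x
      have "c \<in> measurable borel (count_space UNIV)" unfolding c_def by measurable
      moreover have "bounded_colouring \<rho> X d s (2 * (D1 + s + D)) c"
        unfolding bounded_colouring_def
      proof (intro conjI allI impI)
        show "c x \<le> d" for x using ac bc unfolding bounded_colouring_def c_def by simp
        fix i x y assume xy: "(x, y) \<in> chain \<rho> (X \<inter> c -` {i}) s"
        have "X \<inter> c -` {i} = (X \<inter> U \<inter> a -` {i}) \<union> ((X - U) \<inter> b -` {i})"
          unfolding c_def by auto
        then have "(x, y) \<in> chain \<rho> ((X \<inter> U \<inter> a -` {i}) \<union> ((X - U) \<inter> b -` {i})) s"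
          using xy by simp
        then show "\<rho> x y \<le> ennreal (2 * (D1 + s + D))"
          by (rule chain_Un_bounded[rotated 6])
            (use s D D1 ac bc in \<open>auto simp: s1_def bounded_colouring_def\<close>)
      qed
      ultimately show "\<exists>D c. c \<in> measurable borel (count_space UNIV) \<and> bounded_colouring \<rho> X d (2 * r) D c"
        unfolding s_def by blast
    qed
  qed
  then have "asdim_bound ?B X \<rho> = asdim_bound UNIV X \<rho>" by (rule ext)
  then show ?thesis
    unfolding asdim_Borel_def asdim_def asdim_among_def
    by (simp add: space_restrict_space)
qed

text \<open>\<open>X\<close> collects the points whose whole class is covered at every integer
  scale, which makes it invariant at once and comeager as a countable intersection. Restricting a
  cover to \<open>X\<close> only shrinks its components.\<close>

theorem generic_asdim_Borel_eq_asdim: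
  "\<exists>X. rel_invariant UNIV (finite_dist_rel UNIV \<rho>) X \<and> comeager X \<and> X \<in> sets borel \<and>
     asdim_Borel (restrict_space borel X) \<rho> = asdim X \<rho>"
proof -
  have "\<forall>m::nat. \<exists>A. (\<forall>n. A n \<in> sets borel) \<and>
    (\<forall>n x y. x \<in> A n \<longrightarrow> y \<in> A n \<longrightarrow> \<rho> x y \<le> ennreal (sparse_gap (real m) n) \<longrightarrow> x = y) \<and>
    comeager {x. \<forall>i. \<exists>n. f i x \<in> A n}"
  proof
    fix m :: nat
    obtain A where "\<And>n::nat. A n \<in> sets borel"
      "\<And>n x y. x \<in> A n \<Longrightarrow> y \<in> A n \<Longrightarrow> \<rho> x y \<le> ennreal (sparse_gap (real m) n) \<Longrightarrow> x = y"
      "comeager {x. \<forall>i. \<exists>n. f i x \<in> A n}"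
      using generic_sparse_sequence[of "sparse_gap (real m)"] by blast
    then show "\<exists>A. (\<forall>n. A n \<in> sets borel) \<and>
      (\<forall>n x y. x \<in> A n \<longrightarrow> y \<in> A n \<longrightarrow> \<rho> x y \<le> ennreal (sparse_gap (real m) n) \<longrightarrow> x = y) \<and>
      comeager {x. \<forall>i. \<exists>n. f i x \<in> A n}"
      by (intro exI[of _ A]) simp
  qed
  then obtain A where A: "\<forall>m::nat. (\<forall>n. A m n \<in> sets borel) \<and>
    (\<forall>n x y. x \<in> A m n \<longrightarrow> y \<in> A m n \<longrightarrow> \<rho> x y \<le> ennreal (sparse_gap (real m) n) \<longrightarrow> x = y) \<and>
    comeager {x. \<forall>i. \<exists>n. f i x \<in> A m n}"
    by (rule choice[THEN exE])
  then have A_borel[measurable]: "\<And>m n. A m n \<in> sets borel"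
    and sparse: "\<And>m n x y. x \<in> A m n \<Longrightarrow> y \<in> A m n \<Longrightarrow> \<rho> x y \<le> ennreal (sparse_gap (real m) n) \<Longrightarrow> x = y"
    and com: "\<And>m. comeager {x. \<forall>i. \<exists>n. f i x \<in> A m n}" by blast+
  define X where "X = (\<Inter>m. {x. \<forall>i. \<exists>n. f i x \<in> A m n})"
  have X_iff: "x \<in> X \<longleftrightarrow> (\<forall>m y. \<rho> x y < \<infinity> \<longrightarrow> (\<exists>n. y \<in> A m n))" for x
    unfolding X_def enum by auto
  have sat: "y \<in> X" if "x \<in> X" "\<rho> x y < \<infinity>" for x y
    using that rho_finite_trans unfolding X_iff by blast
  have "{x. \<forall>i. \<exists>n. f i x \<in> A m n} \<in> sets borel" for m by measurable
  then have X: "X \<in> sets borel" unfolding X_def by blast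
  have "comeager X" unfolding X_def using com by (rule comeager_INT)
  moreover have "rel_invariant UNIV (finite_dist_rel UNIV \<rho>) X"
    unfolding rel_invariant_def
  proof (intro exI conjI)
    let ?C = "(\<lambda>x. finite_dist_rel UNIV \<rho> `` {x}) ` X"
    show "?C \<subseteq> UNIV // finite_dist_rel UNIV \<rho>" by (auto simp: quotientI)
    show "X = \<Union>?C" using sat unfolding finite_dist_rel_def by fastforce
  qed
  moreover have "asdim_Borel (restrict_space borel X) \<rho> = asdim X \<rho>"
  proof (rule asdim_Borel_eq_asdim[OF X])
    fix m :: nat
    have "\<exists>U\<in>sets borel. (\<forall>x. finite {y. (x, y) \<in> chain \<rho> U (real m)}) \<and>
      (\<forall>x. finite {y. (x, y) \<in> chain \<rho> ((\<Union>n. A m n) - U) (real m)})"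
      by (rule finite_components_cover[where A = "A m"]) (auto intro: sparse)
    then obtain U where U: "U \<in> sets borel" "\<And>x. finite {y. (x, y) \<in> chain \<rho> U (real m)}"
      "\<And>x. finite {y. (x, y) \<in> chain \<rho> ((\<Union>n. A m n) - U) (real m)}" by blast
    have "X \<subseteq> (\<Union>n. A m n)"
    proof
      fix x assume "x \<in> X"
      moreover have "\<rho> x x < \<infinity>" by simp
      ultimately show "x \<in> (\<Union>n. A m n)" unfolding X_iff by blast
    qed
    then have sub: "X - U \<subseteq> (\<Union>n. A m n) - U" by blast
    have "finite {y. (x, y) \<in> chain \<rho> (X \<inter> U) (real m)}" for x
      by (rule finite_subset[OF _ U(2)[of x]]) (use chain_mono[of "X \<inter> U" U] in blast)
    moreover have "finite {y. (x, y) \<in> chain \<rho> (X - U) (real m)}" for x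
      by (rule finite_subset[OF _ U(3)[of x]]) (use chain_mono[OF sub] in blast)
    ultimately show "\<exists>U\<in>sets borel. (\<forall>x. finite {y. (x, y) \<in> chain \<rho> (X \<inter> U) (real m)}) \<and>
      (\<forall>x. finite {y. (x, y) \<in> chain \<rho> (X - U) (real m)})"
      using U(1) by blast
  qed
  ultimately show ?thesis using X by blast
qed

end

theorem theorem1p2:
  fixes \<rho> :: "'a::polish_space \<Rightarrow> 'a \<Rightarrow> ennreal"
  assumes "ext_metric_on UNIV \<rho>"
    and "proper_on UNIV \<rho>"
    and "(\<lambda>(x, y). \<rho> x y) \<in> borel_measurable (borel :: ('a \<times> 'a) measure)"
  shows "\<exists>X' :: 'a set.
           rel_invariant UNIV (finite_dist_rel UNIV \<rho>) X' \<and>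
           comeager X' \<and>
           X' \<in> sets borel \<and>
           asdim_Borel (restrict_space borel X') \<rho> = asdim X' \<rho>"
  using enumerated_metric_exists[OF assms] enumerated_metric.generic_asdim_Borel_eq_asdim by blast

end
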